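(* Let $\alpha\in[0,1)$ and let $n,d$ be integers with $2\le d\le n-2$. Then the graph $U_2^*(n,d)$ is, up to isomorphism, the unique graph with the maximal $\alpha$-spectral radius among all graphs in $\mathscr{U}(n,d)$; that is, $U_2^*(n,d)\in\mathscr{U}(n,d)$ and $\rho_\alpha(G)<\rho_\alpha(U_2^*(n,d))$ for every $G\in\mathscr{U}(n,d)$ not isomorphic to $U_2^*(n,d)$.
   Context: All graphs are finite, undirected and simple. For a graph $G$ with adjacency matrix $A(G)$ and diagonal degree matrix $D(G)$, $A_\alpha(G)=\alpha D(G)+(1-\alpha)A(G)$, and $\rho_\alpha(G)$ (the $\alpha$-spectral radius) is the spectral radius of $A_\alpha(G)$. A unicyclic graph is a connected graph with as many edges as vertices. $\mathscr{U}(n,d)$ is the set of all unicyclic graphs with $n$ vertices and diameter $d$. Let $C_3$ be the triangle with vertices $w_1,w_2,w_3$. For integers $s,a,b\ge 0$, $\Delta_2(s;a,b)$ is the graph obtained from this triangle by attaching $s$ pendant edges and a pendant path of length $a$ (i.e. with $a$ new vertices) at $w_2$, and a pendant path of length $b$ at $w_3$. $U_2^*(n,d)$ is the graph $\Delta_2(s;a,b)$ with $n$ vertices (so $s+a+b+3=n$), $d=a+b+1$ and $0\le a-b\le 1$. *)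

theory Defs
  imports
    Graph_Theory.Graph_Theory
    Jordan_Normal_Form.Spectral_Radius
begin

(* A finite simple undirected graph is a pair_graph of Graph_Theory: a finite, loop-free digraph
   without parallel arcs whose arc relation is symmetric. An undirected edge uv is thus represented
   by the two arcs (u,v) and (v,u), and out_degree is the ordinary vertex degree. *)

definition undirected_edges :: "'a pair_pre_digraph \<Rightarrow> 'a set set" where
  "undirected_edges G = {{u, v} | u v. (u, v) \<in> parcs G}"

(* The constant is qualified because topological connectedness has the same base name. *)
definition unicyclic :: "'a pair_pre_digraph \<Rightarrow> bool" where
  "unicyclic G \<longleftrightarrow>
     pair_graph G \<and> Digraph_Component.connected (with_proj G) \<and>
     card (undirected_edges G) = card (pverts G)"

(* The distance is the cost of a cheapest walk when each arc costs 1. *)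
definition graph_dist :: "'a pair_pre_digraph \<Rightarrow> 'a \<Rightarrow> 'a \<Rightarrow> ereal" where
  "graph_dist G u v = wf_digraph.\<mu> (with_proj G) (\<lambda>_. 1) u v"

definition graph_diameter :: "'a pair_pre_digraph \<Rightarrow> ereal" where
  "graph_diameter G = (SUP u\<in>pverts G. SUP v\<in>pverts G. graph_dist G u v)"

definition unicyclic_graphs :: "nat \<Rightarrow> nat \<Rightarrow> 'a pair_pre_digraph set" where
  "unicyclic_graphs n d =
     {G. unicyclic G \<and> card (pverts G) = n \<and> graph_diameter G = ereal (real d)}"

(* Matrices of G, with rows and columns ordered by an enumeration vs of the vertices. *)

definition adjacency_mat :: "'a list \<Rightarrow> 'a pair_pre_digraph \<Rightarrow> real mat" where
  "adjacency_mat vs G = mat (length vs) (length vs)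
     (\<lambda>(i, j). if (vs ! i, vs ! j) \<in> parcs G then 1 else 0)"

definition degree_mat :: "'a list \<Rightarrow> 'a pair_pre_digraph \<Rightarrow> real mat" where
  "degree_mat vs G = mat (length vs) (length vs)
     (\<lambda>(i, j). if i = j then real (out_degree (with_proj G) (vs ! i)) else 0)"

definition A_alpha :: "real \<Rightarrow> 'a list \<Rightarrow> 'a pair_pre_digraph \<Rightarrow> real mat" where
  "A_alpha \<alpha> vs G = \<alpha> \<cdot>\<^sub>m degree_mat vs G + (1 - \<alpha>) \<cdot>\<^sub>m adjacency_mat vs G"

definition vertex_list :: "'a pair_pre_digraph \<Rightarrow> 'a list" where
  "vertex_list G = (SOME vs. distinct vs \<and> set vs = pverts G)"

(* The choice of enumeration is immaterial: see alpha_spectral_radius_enum below. *)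
definition alpha_spectral_radius :: "real \<Rightarrow> 'a pair_pre_digraph \<Rightarrow> real" where
  "alpha_spectral_radius \<alpha> G =
     spectral_radius (map_mat complex_of_real (A_alpha \<alpha> (vertex_list G) G))"

(* W1, W2, W3 is the triangle; PathA 1, PathA 2, ... and PathB 1, PathB 2, ... are the new vertices
   of the two pendant paths, numbered by their distance from the attachment vertex. *)
datatype delta_vertex = W1 | W2 | W3 | Pendant nat | PathA nat | PathB nat

definition Delta2_links :: "nat \<Rightarrow> nat \<Rightarrow> nat \<Rightarrow> delta_vertex rel" where
  "Delta2_links s a b =
     {(W1, W2), (W2, W3), (W3, W1)}
     \<union> {(W2, Pendant i) | i. 1 \<le> i \<and> i \<le> s}
     \<union> (if 1 \<le> a then {(W2, PathA 1)} else {})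
     \<union> {(PathA i, PathA (i + 1)) | i. 1 \<le> i \<and> i + 1 \<le> a}
     \<union> (if 1 \<le> b then {(W3, PathB 1)} else {})
     \<union> {(PathB i, PathB (i + 1)) | i. 1 \<le> i \<and> i + 1 \<le> b}"

definition Delta2 :: "nat \<Rightarrow> nat \<Rightarrow> nat \<Rightarrow> delta_vertex pair_pre_digraph" where
  "Delta2 s a b =
     \<lparr> pverts = {W1, W2, W3} \<union> Pendant ` {1..s} \<union> PathA ` {1..a} \<union> PathB ` {1..b},
       parcs = Delta2_links s a b \<union> (Delta2_links s a b)\<inverse> \<rparr>"

(* For 1 \<le> d \<le> n - 2 the side conditions have exactly one solution: see U2_star_eq. *)
definition U2_star :: "nat \<Rightarrow> nat \<Rightarrow> delta_vertex pair_pre_digraph" where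
  "U2_star n d = (THE G. \<exists>s a b. s + a + b + 3 = n \<and> d = a + b + 1 \<and>
     0 \<le> int a - int b \<and> int a - int b \<le> 1 \<and> G = Delta2 s a b)"

lemma U2_star_eq:
  assumes "1 \<le> d" "d + 2 \<le> n"
  shows "U2_star n d = Delta2 (n - d - 2) (d div 2) ((d - 1) div 2)"
proof -
  have sol: "s = n - d - 2 \<and> a = d div 2 \<and> b = (d - 1) div 2"
    if "s + a + b + 3 = n" "d = a + b + 1" "0 \<le> int a - int b" "int a - int b \<le> 1" for s a b
  proof -
    have "a = b \<or> a = Suc b" using that by linarith
    then show ?thesis using that by auto
  qed
  have ex: "(n - d - 2) + d div 2 + (d - 1) div 2 + 3 = n" "d = d div 2 + (d - 1) div 2 + 1"
    "0 \<le> int (d div 2) - int ((d - 1) div 2)" "int (d div 2) - int ((d - 1) div 2) \<le> 1"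
    using assms by linarith+
  show ?thesis
    unfolding U2_star_def
  proof (rule the_equality)
    show "\<exists>s a b. s + a + b + 3 = n \<and> d = a + b + 1 \<and> 0 \<le> int a - int b \<and>
        int a - int b \<le> 1 \<and>
        Delta2 (n - d - 2) (d div 2) ((d - 1) div 2) = Delta2 s a b"
      using ex by blast
  next
    fix G
    assume "\<exists>s a b. s + a + b + 3 = n \<and> d = a + b + 1 \<and> 0 \<le> int a - int b \<and>
        int a - int b \<le> 1 \<and> G = Delta2 s a b"
    then obtain s a b where "s + a + b + 3 = n" "d = a + b + 1" "0 \<le> int a - int b"
      "int a - int b \<le> 1" "G = Delta2 s a b" by (elim exE conjE)
    then show "G = Delta2 (n - d - 2) (d div 2) ((d - 1) div 2)"
      using sol[of s a b] by simp
  qed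
qed

lemma A_alpha_index:
  assumes "i < length vs" "j < length vs" "distinct vs"
  shows "A_alpha \<alpha> vs G $$ (i, j) =
    \<alpha> * (if vs ! i = vs ! j then real (out_degree (with_proj G) (vs ! i)) else 0)
    + (1 - \<alpha>) * (if (vs ! i, vs ! j) \<in> parcs G then 1 else 0)"
  using assms by (simp add: A_alpha_def degree_mat_def adjacency_mat_def nth_eq_iff_index_eq)

lemma eigenvalue_A_alpha_iff:
  assumes "distinct vs"
  shows "eigenvalue (map_mat complex_of_real (A_alpha \<alpha> vs G)) k \<longleftrightarrow>
    (\<exists>f. (\<exists>u\<in>set vs. f u \<noteq> 0) \<and> (\<forall>u\<in>set vs.
      (\<Sum>v\<in>set vs. complex_of_real
        (\<alpha> * (if u = v then real (out_degree (with_proj G) u) else 0)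
         + (1 - \<alpha>) * (if (u, v) \<in> parcs G then 1 else 0)) * f v) = k * f u))"
    (is "eigenvalue ?A k \<longleftrightarrow> (\<exists>f. ?ev f)")
proof -
  let ?n = "length vs"
  let ?c = "\<lambda>u v. complex_of_real
        (\<alpha> * (if u = v then real (out_degree (with_proj G) u) else 0)
         + (1 - \<alpha>) * (if (u, v) \<in> parcs G then 1 else 0))"
  have dim: "dim_row ?A = ?n" "dim_col ?A = ?n"
    by (simp_all add: A_alpha_def adjacency_mat_def)
  have idx: "?A $$ (i, j) = ?c (vs ! i) (vs ! j)" if "i < ?n" "j < ?n" for i j
  proof -
    have d: "i < dim_row (A_alpha \<alpha> vs G)" "j < dim_col (A_alpha \<alpha> vs G)"
      using that dim by (simp_all only: index_map_mat)
    show ?thesis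
      unfolding index_map_mat(1)[OF d] A_alpha_index[OF that assms] by (rule refl)
  qed
  have key: "(?A *\<^sub>v x) $ i = (\<Sum>v\<in>set vs. ?c (vs ! i) v * f v)"
    if "x \<in> carrier_vec ?n" "\<And>j. j < ?n \<Longrightarrow> f (vs ! j) = x $ j" "i < ?n" for x f i
  proof -
    have "(?A *\<^sub>v x) $ i = (\<Sum>j = 0..<?n. ?A $$ (i, j) * x $ j)"
      using that dim by (simp only: index_mult_mat_vec scalar_prod_def carrier_vecD)
        (intro sum.cong refl, simp only: index_row atLeastLessThan_iff)
    also have "\<dots> = (\<Sum>j<?n. ?c (vs ! i) (vs ! j) * f (vs ! j))"
      unfolding lessThan_atLeast0 using that(2,3) by (intro sum.cong refl) (simp only: idx atLeastLessThan_iff)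
    also have "\<dots> = (\<Sum>v\<in>set vs. ?c (vs ! i) v * f v)"
      by (rule sum.reindex_bij_betw[OF bij_betw_nth[OF assms refl refl],
          where g = "\<lambda>v. ?c (vs ! i) v * f v"])
    finally show ?thesis .
  qed
  show ?thesis
  proof
    assume "eigenvalue ?A k"
    then obtain x where x: "x \<in> carrier_vec ?n" "x \<noteq> 0\<^sub>v ?n" "?A *\<^sub>v x = k \<cdot>\<^sub>v x"
      unfolding eigenvalue_def eigenvector_def dim by blast
    define f where "f u = x $ (the_inv_into {..<?n} ((!) vs) u)" for u
    have inj: "inj_on ((!) vs) {..<?n}"
      using assms by (auto simp: inj_on_def nth_eq_iff_index_eq)
    have f: "f (vs ! j) = x $ j" if "j < ?n" for j
      unfolding f_def using that by (simp add: the_inv_into_f_f[OF inj])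
    have "\<exists>u\<in>set vs. f u \<noteq> 0"
    proof -
      obtain j where "j < ?n" "x $ j \<noteq> 0"
        using x(1,2) by (metis carrier_vecD eq_vecI index_zero_vec)
      then have "f (vs ! j) \<noteq> 0" using f by simp
      then show ?thesis using \<open>j < ?n\<close> nth_mem by blast
    qed
    moreover have "(\<Sum>v\<in>set vs. ?c u v * f v) = k * f u" if u: "u \<in> set vs" for u
    proof -
      obtain i where i: "i < ?n" "u = vs ! i" using u by (metis in_set_conv_nth)
      show ?thesis
        unfolding i(2) using key[of x f i, OF x(1) f i(1)] x(1) i(1)
        by (simp only: x(3) f[OF i(1)] index_smult_vec carrier_vecD)
    qed
    ultimately show "\<exists>f. ?ev f" by blast
  next
    assume "\<exists>f. ?ev f"
    then obtain f where f: "\<exists>u\<in>set vs. f u \<noteq> 0"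
      "\<And>u. u \<in> set vs \<Longrightarrow> (\<Sum>v\<in>set vs. ?c u v * f v) = k * f u" by blast
    define x where "x = vec ?n (\<lambda>j. f (vs ! j))"
    have x: "x \<in> carrier_vec ?n" by (simp add: x_def)
    have xj: "f (vs ! j) = x $ j" if "j < ?n" for j using that by (simp add: x_def)
    obtain u where u: "u \<in> set vs" "f u \<noteq> 0" using f(1) by blast
    obtain j where j: "j < ?n" "u = vs ! j" using u(1) by (metis in_set_conv_nth)
    have "x \<noteq> 0\<^sub>v ?n" using u(2) xj[OF j(1)] j by auto
    moreover have "?A *\<^sub>v x = k \<cdot>\<^sub>v x"
    proof (rule eq_vecI)
      fix i assume "i < dim_vec (k \<cdot>\<^sub>v x)"
      then have i: "i < ?n" using x by simp
      have "(?A *\<^sub>v x) $ i = k * x $ i"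
        using key[of x f i, OF x xj i] f(2)[OF nth_mem[OF i]] xj[OF i] by (simp only:)
      then show "(?A *\<^sub>v x) $ i = (k \<cdot>\<^sub>v x) $ i"
        using x i by (simp only: index_smult_vec carrier_vecD)
    qed (use x dim in \<open>simp only: dim_mult_mat_vec index_smult_vec carrier_vecD\<close>)
    ultimately show "eigenvalue ?A k"
      unfolding eigenvalue_def eigenvector_def dim using x by blast
  qed
qed

lemma alpha_spectral_radius_enum:
  assumes "distinct vs" "set vs = pverts G"
  shows "alpha_spectral_radius \<alpha> G =
    spectral_radius (map_mat complex_of_real (A_alpha \<alpha> vs G))"
proof -
  have *: "distinct (vertex_list G) \<and> set (vertex_list G) = pverts G"
    unfolding vertex_list_def by (rule someI[of _ vs]) (use assms in blast)
  have "eigenvalue (map_mat complex_of_real (A_alpha \<alpha> (vertex_list G) G)) k \<longleftrightarrow>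
      eigenvalue (map_mat complex_of_real (A_alpha \<alpha> vs G)) k" for k
    using * assms by (simp only: eigenvalue_A_alpha_iff)
  then show ?thesis
    unfolding alpha_spectral_radius_def spectral_radius_def spectrum_def by presburger
qed

end

theory Submission
  imports Defs "HOL-Analysis.Function_Topology"
begin

text \<open>
  For a graph \<open>G\<close> the quadratic form of \<open>A\<^sub>\<alpha>(G)\<close> is a sum over the edges \<open>st\<close> of
  \<open>\<alpha> (x s\<^sup>2 + x t\<^sup>2) + 2 (1 - \<alpha>) x s x t\<close>, which is nondecreasing in both values as long as they are
  nonnegative. Let \<open>x\<close> be the positive Perron vector of a graph \<open>G\<close> in the class, and \<open>r\<close> a vertex
  where \<open>x\<close> is largest. The proof transports \<open>x\<close> to the extremal graph \<open>U\<close> along a bijection of the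
  vertices under which the quadratic form does not decrease. By the Rayleigh principle
  \<open>\<rho>(G) \<le> \<rho>(U)\<close>, and if equality holds then the transported vector is an eigenvector of \<open>U\<close> as well.

  To find the bijection, take a breadth-first search tree of \<open>G\<close> rooted at \<open>r\<close>. Exactly one edge
  \<open>uv\<close> is outside the tree, and it avoids \<open>r\<close>. Since \<open>x r\<close> is maximal, making a vertex a child of
  \<open>r\<close> instead of its parent does not decrease the form. Starting from two vertices \<open>p\<close>, \<open>q\<close> at
  distance \<open>d\<close>, the tree paths towards \<open>r\<close> contain two disjoint chains with \<open>d\<close> vertices in total,
  and not both \<open>u\<close> and \<open>v\<close> lie on them (\<open>two_chains\<close>); say \<open>v\<close> does not. Now hang the two chains and
  all the other vertices directly at \<open>r\<close>. Let \<open>y\<^sub>0 \<ge> y\<^sub>1 \<ge> \<dots>\<close> be the values on the chains. By the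
  rearrangement inequality (\<open>edge_form_rearrangement\<close>) the best way to assign parents to them is to
  put \<open>y\<^sub>0\<close> and \<open>y\<^sub>1\<close> below \<open>r\<close> and \<open>y\<^sub>k\<close> below \<open>y\<^sub>k\<^sub>-\<^sub>2\<close>: two branches whose lengths differ by at most
  one (\<open>chain_sum_le\<close>). The extra edge finally joins \<open>v\<close> to the vertex with value \<open>y\<^sub>0\<close>, after \<open>u\<close> has
  been exchanged for that vertex if \<open>u\<close> is off the chains and has the larger value. The graph so
  obtained is \<open>U\<close>: the vertex \<open>y\<^sub>0\<close> is \<open>W3\<close>, its branch is \<open>PathB\<close>, and the other one is \<open>PathA\<close>.

  In the case of equality, \<open>x\<close> satisfies the eigenvalue equations of both graphs, with the same
  eigenvalue. Comparing them at \<open>r\<close> shows that all vertices off the chains, and the tops of both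
  chains, are adjacent to \<open>r\<close> (\<open>root_row\<close>). Comparing them at \<open>u\<close> and \<open>v\<close> shows that \<open>u\<close> is the top of
  a chain unless \<open>d = 2\<close> (\<open>par_u\<close>), and comparing them along the other chain shows that it is as long
  as \<open>PathA\<close> (\<open>pendant_path_length_le\<close>). Hence \<open>G\<close> is isomorphic to \<open>U\<close>.
\<close>

section \<open>The Rayleigh principle\<close>

text \<open>
  The unit sphere is compact. Coordinates outside \<open>V\<close> are pinned to \<open>0\<close>, which turns it into a
  closed subset of a product of compact intervals.
\<close>

lemma rayleigh_quotient_attains_max:
  fixes c :: "'v \<Rightarrow> 'v \<Rightarrow> real"
  assumes fin: "finite V" and ne: "V \<noteq> {}"
  shows "\<exists>x. (\<Sum>u\<in>V. (x u)\<^sup>2) = 1 \<and>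
    (\<forall>y. (\<Sum>u\<in>V. \<Sum>v\<in>V. c u v * y u * y v)
       \<le> (\<Sum>u\<in>V. \<Sum>v\<in>V. c u v * x u * x v) * (\<Sum>u\<in>V. (y u)\<^sup>2))"
proof -
  let ?Q = "\<lambda>x :: 'v \<Rightarrow> real. \<Sum>u\<in>V. \<Sum>v\<in>V. c u v * x u * x v"
  let ?N = "\<lambda>x :: 'v \<Rightarrow> real. \<Sum>u\<in>V. (x u)\<^sup>2"
  define B where "B = PiE UNIV (\<lambda>u. if u \<in> V then {-1..1} else {0::real})"
  define S where "S = B \<inter> {x. ?N x = 1}"
  have "compactin (product_topology (\<lambda>_. euclidean) UNIV) B"
    unfolding B_def by (subst compactin_PiE) auto
  then have "compact B"
    by (simp add: euclidean_product_topology compactin_euclidean_iff)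
  moreover have "closed {x. ?N x = 1}"
    by (intro closed_Collect_eq continuous_intros) simp
  ultimately have "compact S"
    unfolding S_def by (rule compact_Int_closed)
  have S_normalized: "(\<lambda>u. if u \<in> V then y u / sqrt (?N y) else 0) \<in> S" if "?N y \<noteq> 0" for y
  proof -
    have pos: "0 < ?N y" using that sum_nonneg[of V "\<lambda>u. (y u)\<^sup>2"] by fastforce
    have "\<bar>y u / sqrt (?N y)\<bar> \<le> 1" if "u \<in> V" for u
    proof -
      have "(y u)\<^sup>2 \<le> ?N y" using that fin by (intro member_le_sum) auto
      then have "\<bar>y u\<bar> \<le> sqrt (?N y)"
        using real_le_rsqrt[of "\<bar>y u\<bar>"] by simp
      then show ?thesis using pos by (simp add: abs_divide)
    qed
    then have "-1 \<le> y u / sqrt (?N y) \<and> y u / sqrt (?N y) \<le> 1" if "u \<in> V" for u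
      using that unfolding abs_le_iff by force
    then have "(\<lambda>u. if u \<in> V then y u / sqrt (?N y) else 0) \<in> B"
      by (auto simp: B_def PiE_def)
    moreover have "(\<Sum>u\<in>V. (y u / sqrt (?N y))\<^sup>2) = 1"
      using pos by (simp add: power_divide flip: sum_divide_distrib)
    ultimately show ?thesis by (simp add: S_def)
  qed
  have "S \<noteq> {}"
  proof -
    have "?N (\<lambda>_. 1) \<noteq> 0" using fin ne by simp
    from S_normalized[OF this] show ?thesis by blast
  qed
  moreover have "continuous_on S ?Q"
    by (intro continuous_intros continuous_on_subset[OF continuous_on_product_coordinates]) auto
  ultimately obtain x where x: "x \<in> S" "\<And>y. y \<in> S \<Longrightarrow> ?Q y \<le> ?Q x"
    using continuous_attains_sup[OF \<open>compact S\<close>] by blast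
  have "?Q y \<le> ?Q x * ?N y" for y
  proof (cases "?N y = 0")
    case True
    then have "y u = 0" if "u \<in> V" for u
      using that fin by (simp add: sum_nonneg_eq_0_iff)
    then have "?Q y = 0" by simp
    then show ?thesis using True by simp
  next
    case False
    then have pos: "0 < ?N y" using sum_nonneg[of V "\<lambda>u. (y u)\<^sup>2"] by fastforce
    have "(\<Sum>u\<in>V. \<Sum>v\<in>V. c u v * (y u / sqrt (?N y)) * (y v / sqrt (?N y))) \<le> ?Q x"
      using x(2)[OF S_normalized[OF False]] by simp
    moreover have "(\<Sum>u\<in>V. \<Sum>v\<in>V. c u v * (y u / sqrt (?N y)) * (y v / sqrt (?N y)))
        = (\<Sum>u\<in>V. \<Sum>v\<in>V. c u v * y u * y v / ?N y)"
      using pos by (intro sum.cong refl) (simp add: field_simps)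
    also have "\<dots> = ?Q y / ?N y" by (simp add: sum_divide_distrib)
    ultimately show ?thesis using pos by (simp add: divide_le_eq)
  qed
  then show ?thesis using x(1) by (auto simp: S_def)
qed

lemma linear_part_zero:
  fixes p q :: real
  assumes "\<And>t. 2 * t * p + t\<^sup>2 * q \<le> 0"
  shows "p = 0"
proof -
  \<comment> \<open>at \<open>t = p / k\<close> the linear term dominates the quadratic one\<close>
  define k where "k = \<bar>q\<bar> + 1"
  have k: "k > 0" "2 * k + q > 0" by (auto simp: k_def)
  have "2 * (p / k) * p + (p / k)\<^sup>2 * q \<le> 0" by (rule assms)
  moreover have "2 * (p / k) * p + (p / k)\<^sup>2 * q = p\<^sup>2 * (2 * k + q) / k\<^sup>2"
    using k by (simp add: field_simps power2_eq_square)
  ultimately have "p\<^sup>2 * (2 * k + q) \<le> 0" using k by (simp add: divide_le_0_iff)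
  then have "p\<^sup>2 \<le> 0" using k by (simp add: mult_le_0_iff)
  then show ?thesis by simp
qed

text \<open>
  First-order optimality: changing a maximizer \<open>x\<close> by \<open>t\<close> in the coordinate \<open>w\<close> changes
  \<open>Q(x) - \<mu> \<parallel>x\<parallel>\<^sup>2\<close> by a quadratic polynomial in \<open>t\<close> which is nowhere positive and vanishes at \<open>0\<close>, so
  its linear coefficient is \<open>0\<close>.
\<close>

lemma rayleigh_equality_imp_eigenvector:
  fixes c :: "'v \<Rightarrow> 'v \<Rightarrow> real"
  assumes fin: "finite V"
    and sym: "\<And>u v. u \<in> V \<Longrightarrow> v \<in> V \<Longrightarrow> c u v = c v u"
    and max: "\<And>y. (\<Sum>u\<in>V. \<Sum>v\<in>V. c u v * y u * y v) \<le> \<mu> * (\<Sum>u\<in>V. (y u)\<^sup>2)"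
    and eq: "(\<Sum>u\<in>V. \<Sum>v\<in>V. c u v * x u * x v) = \<mu> * (\<Sum>u\<in>V. (x u)\<^sup>2)"
    and w: "w \<in> V"
  shows "(\<Sum>v\<in>V. c w v * x v) = \<mu> * x w"
proof -
  let ?r = "\<Sum>v\<in>V. c w v * x v"
  have "2 * t * (?r - \<mu> * x w) + t\<^sup>2 * (c w w - \<mu>) \<le> 0" for t
  proof -
    define e where "e u = (if u = w then t else 0)" for u
    have e: "(\<Sum>u\<in>V. f u * e u) = f w * t" "(\<Sum>u\<in>V. e u * f u) = t * f w" for f :: "'v \<Rightarrow> real"
      using fin w by (simp_all add: e_def if_distrib[of "\<lambda>z. _ * z"] if_distrib[of "\<lambda>z. z * _"] cong: if_cong)
    have "(\<Sum>u\<in>V. \<Sum>v\<in>V. c u v * (x u + e u) * (x v + e v))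
       = (\<Sum>u\<in>V. \<Sum>v\<in>V. c u v * x u * x v) + (\<Sum>u\<in>V. \<Sum>v\<in>V. (c u v * x u) * e v)
         + (\<Sum>u\<in>V. \<Sum>v\<in>V. e u * (c u v * x v)) + (\<Sum>u\<in>V. \<Sum>v\<in>V. (e u * c u v) * e v)"
      unfolding sum.distrib[symmetric] by (intro sum.cong refl) (simp add: algebra_simps)
    also have "\<dots> = \<mu> * (\<Sum>u\<in>V. (x u)\<^sup>2) + (\<Sum>u\<in>V. c u w * x u) * t + t * ?r + t * c w w * t"
      unfolding eq e sum_distrib_left[symmetric]
      by (simp add: e sum_distrib_right mult.assoc)
    also have "(\<Sum>u\<in>V. c u w * x u) = ?r"
      using sym w by (intro sum.cong) auto
    finally have 1: "(\<Sum>u\<in>V. \<Sum>v\<in>V. c u v * (x u + e u) * (x v + e v))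
      = \<mu> * (\<Sum>u\<in>V. (x u)\<^sup>2) + ?r * t + t * ?r + t * c w w * t" .
    have "(\<Sum>u\<in>V. (x u + e u)\<^sup>2) = (\<Sum>u\<in>V. (x u)\<^sup>2) + (\<Sum>u\<in>V. (2 * x u + e u) * e u)"
      unfolding sum.distrib[symmetric]
      by (intro sum.cong refl) (simp add: algebra_simps power2_eq_square)
    also have "\<dots> = (\<Sum>u\<in>V. (x u)\<^sup>2) + (2 * x w + t) * t"
      unfolding e by (simp add: e_def)
    finally have 2: "(\<Sum>u\<in>V. (x u + e u)\<^sup>2) = (\<Sum>u\<in>V. (x u)\<^sup>2) + (2 * x w + t) * t" .
    show ?thesis
      using max[of "\<lambda>u. x u + e u"] unfolding 1 2 by (simp add: algebra_simps power2_eq_square)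
  qed
  from linear_part_zero[OF this] show ?thesis by simp
qed

section \<open>The \<open>\<alpha>\<close>-spectral radius as a maximum\<close>

definition neighbours :: "'a pair_pre_digraph \<Rightarrow> 'a \<Rightarrow> 'a set" where
  "neighbours G u = {v. (u, v) \<in> parcs G}"

text \<open>
  The product of \<open>A\<^sub>\<alpha>(G)\<close> with a vector, with one summand per edge at \<open>u\<close>: the degree term is spread
  over the neighbours.
\<close>

definition alpha_op :: "real \<Rightarrow> 'a pair_pre_digraph \<Rightarrow> ('a \<Rightarrow> real) \<Rightarrow> 'a \<Rightarrow> real" where
  "alpha_op \<alpha> G x u = (\<Sum>v\<in>neighbours G u. \<alpha> * x u + (1 - \<alpha>) * x v)"

definition alpha_form :: "real \<Rightarrow> 'a pair_pre_digraph \<Rightarrow> ('a \<Rightarrow> real) \<Rightarrow> real" where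
  "alpha_form \<alpha> G x = (\<Sum>u\<in>pverts G. x u * alpha_op \<alpha> G x u)"

definition sqnorm :: "'a pair_pre_digraph \<Rightarrow> ('a \<Rightarrow> real) \<Rightarrow> real" where
  "sqnorm G x = (\<Sum>u\<in>pverts G. (x u)\<^sup>2)"

definition alpha_entry :: "real \<Rightarrow> 'a pair_pre_digraph \<Rightarrow> 'a \<Rightarrow> 'a \<Rightarrow> real" where
  "alpha_entry \<alpha> G u v = \<alpha> * (if u = v then real (out_degree (with_proj G) u) else 0)
     + (1 - \<alpha>) * (if (u, v) \<in> parcs G then 1 else 0)"

lemma neighbours_subset:
  assumes "pair_graph G"
  shows "neighbours G u \<subseteq> pverts G" "finite (neighbours G u)"
proof -
  interpret pair_graph G by fact
  show *: "neighbours G u \<subseteq> pverts G" by (auto simp: neighbours_def dest: in_arcsD2)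
  show "finite (neighbours G u)" by (rule finite_subset[OF * pair_finite_verts])
qed

lemma parcs_sym:
  assumes "pair_graph G" "(u, v) \<in> parcs G"
  shows "(v, u) \<in> parcs G"
proof -
  interpret pair_graph G by fact
  show ?thesis using pair_sym_arcs assms(2) by (auto simp: symmetric_def dest: symD)
qed

lemma out_degree_eq_card_neighbours:
  "out_degree (with_proj G) u = card (neighbours G u)"
proof -
  have "out_arcs (with_proj G) u = Pair u ` neighbours G u"
    by (auto simp: out_arcs_def neighbours_def)
  then show ?thesis by (simp add: out_degree_def card_image inj_on_def)
qed

lemma sum_alpha_entry:
  assumes "pair_graph G" "u \<in> pverts G"
  shows "(\<Sum>v\<in>pverts G. alpha_entry \<alpha> G u v * x v) = alpha_op \<alpha> G x u"
proof -
  interpret pair_graph G by fact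
  have fin: "finite (pverts G)" by (rule pair_finite_verts)
  have n: "neighbours G u = {v \<in> pverts G. (u, v) \<in> parcs G}"
    using neighbours_subset(1)[OF assms(1)] by (auto simp: neighbours_def)
  have "(\<Sum>v\<in>pverts G. alpha_entry \<alpha> G u v * x v)
     = (\<Sum>v\<in>pverts G. (if u = v then \<alpha> * card (neighbours G u) * x v else 0))
       + (\<Sum>v\<in>pverts G. (if (u, v) \<in> parcs G then (1 - \<alpha>) * x v else 0))"
    unfolding sum.distrib[symmetric]
    by (intro sum.cong refl) (simp add: alpha_entry_def out_degree_eq_card_neighbours, simp add: distrib_right)
  also have "\<dots> = \<alpha> * card (neighbours G u) * x u + (\<Sum>v\<in>neighbours G u. (1 - \<alpha>) * x v)"
    unfolding n using fin assms(2) by (simp add: sum.inter_filter)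
  also have "\<dots> = alpha_op \<alpha> G x u"
    by (simp add: alpha_op_def sum.distrib)
  finally show ?thesis .
qed

lemma alpha_form_entry:
  assumes "pair_graph G"
  shows "(\<Sum>u\<in>pverts G. \<Sum>v\<in>pverts G. alpha_entry \<alpha> G u v * x u * x v) = alpha_form \<alpha> G x"
  unfolding alpha_form_def
  by (intro sum.cong refl)
    (simp add: sum_alpha_entry[OF assms, symmetric] sum_distrib_left mult_ac)

text \<open>
  Let \<open>\<mu>\<close> be the maximum of the Rayleigh quotient. Passing to absolute values shows that a nonnegative
  vector attains it, which is then an eigenvector for \<open>\<mu>\<close>. No complex eigenvalue \<open>k\<close> has a larger
  modulus: if \<open>f\<close> is an eigenvector for \<open>k\<close>, the Rayleigh quotient of \<open>\<bar>f\<bar>\<close> is at least \<open>\<bar>k\<bar>\<close>.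
\<close>

lemma alpha_spectral_radius_variational:
  assumes G: "pair_graph G" and ne: "pverts G \<noteq> {}" and \<alpha>: "0 \<le> \<alpha>" "\<alpha> < 1"
  shows alpha_form_le: "alpha_form \<alpha> G y \<le> alpha_spectral_radius \<alpha> G * sqnorm G y" (is ?le)
    and alpha_form_eq_imp_eigenvector:
      "alpha_form \<alpha> G y = alpha_spectral_radius \<alpha> G * sqnorm G y \<Longrightarrow> w \<in> pverts G \<Longrightarrow>
        alpha_op \<alpha> G y w = alpha_spectral_radius \<alpha> G * y w"
    and nonneg_eigenvector_exists:
      "\<exists>x. (\<forall>u. 0 \<le> x u) \<and> (\<exists>u\<in>pverts G. x u \<noteq> 0) \<and>
         (\<forall>u\<in>pverts G. alpha_op \<alpha> G x u = alpha_spectral_radius \<alpha> G * x u)" (is ?ex)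
proof -
  interpret pair_graph G by fact
  let ?V = "pverts G"
  let ?c = "alpha_entry \<alpha> G"
  have fin: "finite ?V" by (rule pair_finite_verts)
  have c_nonneg: "0 \<le> ?c u v" for u v using \<alpha> by (simp add: alpha_entry_def)
  have c_sym: "?c u v = ?c v u" for u v
    using parcs_sym[OF G] by (auto simp: alpha_entry_def)
  obtain x0 where x0: "(\<Sum>u\<in>?V. (x0 u)\<^sup>2) = 1"
    "\<And>y. (\<Sum>u\<in>?V. \<Sum>v\<in>?V. ?c u v * y u * y v)
      \<le> (\<Sum>u\<in>?V. \<Sum>v\<in>?V. ?c u v * x0 u * x0 v) * (\<Sum>u\<in>?V. (y u)\<^sup>2)"
    using rayleigh_quotient_attains_max[OF fin ne, of ?c] by blast
  define \<mu> where "\<mu> = (\<Sum>u\<in>?V. \<Sum>v\<in>?V. ?c u v * x0 u * x0 v)"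
  define x where "x u = \<bar>x0 u\<bar>" for u
  have le: "(\<Sum>u\<in>?V. \<Sum>v\<in>?V. ?c u v * y u * y v) \<le> \<mu> * (\<Sum>u\<in>?V. (y u)\<^sup>2)" for y
    using x0(2) by (simp add: \<mu>_def)
  have nx: "(\<Sum>u\<in>?V. (x u)\<^sup>2) = 1" using x0(1) by (simp add: x_def)
  have "\<mu> \<le> (\<Sum>u\<in>?V. \<Sum>v\<in>?V. ?c u v * x u * x v)"
    unfolding \<mu>_def
  proof (intro sum_mono)
    fix u v
    have "x0 u * x0 v \<le> \<bar>x0 u\<bar> * \<bar>x0 v\<bar>" by (metis abs_ge_self abs_mult)
    then show "?c u v * x0 u * x0 v \<le> ?c u v * x u * x v"
      using c_nonneg[of u v] by (simp add: x_def mult.assoc mult_left_mono)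
  qed
  then have eqx: "(\<Sum>u\<in>?V. \<Sum>v\<in>?V. ?c u v * x u * x v) = \<mu> * (\<Sum>u\<in>?V. (x u)\<^sup>2)"
    using le[of x] nx by simp
  have eig: "(\<Sum>v\<in>?V. ?c u v * y v) = \<mu> * y u"
    if "(\<Sum>u\<in>?V. \<Sum>v\<in>?V. ?c u v * y u * y v) = \<mu> * (\<Sum>u\<in>?V. (y u)\<^sup>2)" "u \<in> ?V" for y u
    using rayleigh_equality_imp_eigenvector[of ?V ?c, OF fin c_sym le that] .
  have xne: "\<exists>u\<in>?V. x u \<noteq> 0"
    using nx by (metis (mono_tags, lifting) sum.neutral zero_neq_one zero_power2)
  have "0 \<le> (\<Sum>u\<in>?V. \<Sum>v\<in>?V. ?c u v * x u * x v)"
    using c_nonneg by (intro sum_nonneg mult_nonneg_nonneg) (auto simp: x_def)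
  then have mu0: "0 \<le> \<mu>" using eqx nx by simp
  obtain vs where vs: "distinct vs" "set vs = ?V"
    using finite_distinct_list[OF fin] by blast
  let ?M = "map_mat complex_of_real (A_alpha \<alpha> vs G)"
  have M: "?M \<in> carrier_mat (length vs) (length vs)"
    by (rule carrier_matI) (simp_all add: A_alpha_def adjacency_mat_def)
  have ev: "eigenvalue ?M k \<longleftrightarrow> (\<exists>f. (\<exists>u\<in>?V. f u \<noteq> 0) \<and>
      (\<forall>u\<in>?V. (\<Sum>v\<in>?V. complex_of_real (?c u v) * f v) = k * f u))" for k
    using eigenvalue_A_alpha_iff[OF vs(1), of \<alpha> G k] by (simp only: vs(2) alpha_entry_def)
  have mem: "complex_of_real \<mu> \<in> spectrum ?M"
  proof -
    have "(\<Sum>v\<in>?V. complex_of_real (?c u v) * complex_of_real (x v))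
        = complex_of_real \<mu> * complex_of_real (x u)" if "u \<in> ?V" for u
      using eig[OF eqx that]
      by (metis (no_types, lifting) of_real_mult of_real_sum sum.cong)
    then show ?thesis unfolding spectrum_def mem_Collect_eq ev
      using xne by (intro exI[of _ "\<lambda>u. complex_of_real (x u)"]) auto
  qed
  have bound: "norm k \<le> \<mu>" if "k \<in> spectrum ?M" for k
  proof -
    have "eigenvalue ?M k" using that by (simp only: spectrum_def mem_Collect_eq)
    then obtain f where f0: "\<exists>u\<in>?V. f u \<noteq> 0"
      "\<forall>u\<in>?V. (\<Sum>v\<in>?V. complex_of_real (?c u v) * f v) = k * f u"
      unfolding ev by (elim exE conjE) (rule that)
    note f = f0(1) f0(2)[rule_format]
    define y where "y u = norm (f u)" for u
    have "norm k * y u \<le> (\<Sum>v\<in>?V. ?c u v * y v)" if "u \<in> ?V" for u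
    proof -
      have "norm k * y u = norm (\<Sum>v\<in>?V. complex_of_real (?c u v) * f v)"
        using f(2)[OF that] by (simp add: y_def norm_mult)
      also have "\<dots> \<le> (\<Sum>v\<in>?V. norm (complex_of_real (?c u v) * f v))" by (rule norm_sum)
      also have "\<dots> = (\<Sum>v\<in>?V. ?c u v * y v)"
        using c_nonneg by (simp add: y_def norm_mult)
      finally show ?thesis .
    qed
    then have "(\<Sum>u\<in>?V. y u * (norm k * y u)) \<le> (\<Sum>u\<in>?V. y u * (\<Sum>v\<in>?V. ?c u v * y v))"
      by (intro sum_mono mult_left_mono) (auto simp: y_def)
    also have "\<dots> \<le> \<mu> * (\<Sum>u\<in>?V. (y u)\<^sup>2)"
      using le[of y] by (simp add: sum_distrib_left mult_ac)
    finally have "norm k * (\<Sum>u\<in>?V. (y u)\<^sup>2) \<le> \<mu> * (\<Sum>u\<in>?V. (y u)\<^sup>2)"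
      by (simp add: sum_distrib_left power2_eq_square mult_ac)
    moreover have "0 < (\<Sum>u\<in>?V. (y u)\<^sup>2)"
      using f(1) fin by (auto simp: y_def intro!: sum_pos2)
    ultimately show ?thesis by simp
  qed
  have "spectral_radius ?M = \<mu>"
    unfolding spectral_radius_def
  proof (rule Max_eqI)
    show "finite (norm ` spectrum ?M)" using card_finite_spectrum(1)[OF M] by simp
    show "\<mu> \<in> norm ` spectrum ?M"
      using mem mu0 by (metis abs_of_nonneg image_eqI norm_of_real)
  qed (use bound in auto)
  then have \<rho>: "alpha_spectral_radius \<alpha> G = \<mu>"
    using alpha_spectral_radius_enum[OF vs] by simp
  note form = alpha_form_entry[OF G] and opr = sum_alpha_entry[OF G]
  show ?le using le[of y] by (simp only: \<rho> form sqnorm_def)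
  show "alpha_op \<alpha> G y w = alpha_spectral_radius \<alpha> G * y w"
    if "alpha_form \<alpha> G y = alpha_spectral_radius \<alpha> G * sqnorm G y" "w \<in> pverts G"
    using eig[of y w] that by (simp only: \<rho> form opr sqnorm_def)
  have "0 \<le> x u" for u by (simp add: x_def)
  then show ?ex using eig[OF eqx] xne by (intro exI[of _ x]) (auto simp: \<rho> opr)
qed

text \<open>
  The contribution of one edge to the quadratic form.
\<close>

definition edge_form :: "real \<Rightarrow> real \<Rightarrow> real \<Rightarrow> real" where
  "edge_form \<alpha> s t = \<alpha> * (s\<^sup>2 + t\<^sup>2) + 2 * (1 - \<alpha>) * s * t"

lemma edge_form_mono:
  assumes "0 \<le> \<alpha>" "\<alpha> < 1" "0 \<le> s" "s \<le> s'" "0 \<le> t" "t \<le> t'"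
  shows "edge_form \<alpha> s t \<le> edge_form \<alpha> s' t'"
proof -
  have "s\<^sup>2 + t\<^sup>2 \<le> s'\<^sup>2 + t'\<^sup>2" using assms by (intro add_mono power_mono) auto
  moreover have "s * t \<le> s' * t'" using assms by (intro mult_mono) auto
  ultimately have "\<alpha> * (s\<^sup>2 + t\<^sup>2) \<le> \<alpha> * (s'\<^sup>2 + t'\<^sup>2)"
    and "2 * (1 - \<alpha>) * (s * t) \<le> 2 * (1 - \<alpha>) * (s' * t')"
    using assms by (auto intro: mult_left_mono)
  then show ?thesis by (simp add: edge_form_def mult.assoc)
qed

lemma connected_imp_rtrancl:
  assumes G: "pair_graph G" and c: "Digraph_Component.connected (with_proj G)"
    and u: "u \<in> pverts G" and v: "v \<in> pverts G"
  shows "(u, v) \<in> (parcs G)\<^sup>*"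
proof -
  interpret pair_graph G by fact
  have "u \<rightarrow>\<^sup>*\<^bsub>with_proj (mk_symmetric (with_proj G))\<^esub> v"
    using c u v unfolding Digraph_Component.connected_def strongly_connected_def by simp
  then have "u \<rightarrow>\<^sup>*\<^bsub>with_proj G\<^esub> v"
    using reachable_mk_symmetric_eq[OF pair_sym_arcs] by simp
  then have "(u, v) \<in> rtrancl_on (pverts G) (parcs G)"
    by (simp add: reachable_def)
  then show ?thesis
    using rtrancl_on_sub_rtrancl by blast
qed

text \<open>
  At a vertex with value \<open>0\<close> the eigenvalue equation forces all its neighbours to have the value \<open>0\<close>,
  and in a connected graph this would spread everywhere.
\<close>

lemma nonneg_eigenvector_pos:
  assumes G: "pair_graph G" and c: "Digraph_Component.connected (with_proj G)"
    and \<alpha>: "0 \<le> \<alpha>" "\<alpha> < 1"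
    and x: "\<And>u. 0 \<le> x u" "w \<in> pverts G" "x w \<noteq> 0"
    and eig: "\<And>u. u \<in> pverts G \<Longrightarrow> alpha_op \<alpha> G x u = \<mu> * x u"
    and v: "v \<in> pverts G"
  shows "0 < x v"
proof -
  have "0 < x w" using x(1)[of w] x(3) by simp
  have "(w, v) \<in> (parcs G)\<^sup>*" by (rule connected_imp_rtrancl[OF G c x(2) v])
  then show ?thesis
  proof (induction rule: rtrancl_induct)
    case base
    show ?case by fact
  next
    case (step s t)
    interpret pair_graph G by fact
    have t: "t \<in> pverts G" using step(2) in_arcsD2 by blast
    show ?case
    proof (rule ccontr)
      assume "\<not> 0 < x t"
      then have 0: "x t = 0" using x(1)[of t] by simp
      have "(\<Sum>s\<in>neighbours G t. (1 - \<alpha>) * x s) = 0"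
        using eig[OF t] by (simp add: alpha_op_def 0)
      moreover have "s \<in> neighbours G t"
        using parcs_sym[OF G step(2)] by (simp add: neighbours_def)
      ultimately have "(1 - \<alpha>) * x s = 0"
        using x(1) \<alpha> neighbours_subset(2)[OF G] by (subst (asm) sum_nonneg_eq_0_iff) auto
      then show False using step(3) \<alpha> by simp
    qed
  qed
qed

lemma perron_vector_exists:
  assumes G: "pair_graph G" and c: "Digraph_Component.connected (with_proj G)"
    and ne: "pverts G \<noteq> {}" and \<alpha>: "0 \<le> \<alpha>" "\<alpha> < 1"
  obtains x where "\<And>v. v \<in> pverts G \<Longrightarrow> 0 < x v"
    "\<And>u. u \<in> pverts G \<Longrightarrow> alpha_op \<alpha> G x u = alpha_spectral_radius \<alpha> G * x u"
  using nonneg_eigenvector_exists[OF G ne \<alpha>] nonneg_eigenvector_pos[OF G c \<alpha>] by metis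

section \<open>Distances and the diameter\<close>

lemma awalk_imp_relpow:
  assumes "pair_graph G" "pre_digraph.awalk (with_proj G) u p v"
  shows "(u, v) \<in> parcs G ^^ length p"
proof -
  interpret pair_graph G by fact
  show ?thesis using assms(2)
  proof (induction p arbitrary: u)
    case Nil
    then show ?case by (simp add: awalk_Nil_iff)
  next
    case (Cons e p)
    then have "(u, snd e) \<in> parcs G" "(snd e, v) \<in> parcs G ^^ length p"
      by (auto simp: awalk_Cons_iff)
    then show ?case by (metis length_Cons relpow_Suc_I2)
  qed
qed

lemma relpow_imp_awalk:
  assumes "pair_graph G" "u \<in> pverts G" "(u, v) \<in> parcs G ^^ k"
  obtains p where "pre_digraph.awalk (with_proj G) u p v" "length p = k"
proof -
  interpret pair_graph G by fact
  have "\<exists>p. awalk u p v \<and> length p = k" using assms(2,3)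
  proof (induction k arbitrary: u)
    case 0
    then show ?case by (auto simp: awalk_Nil_iff)
  next
    case (Suc k)
    then obtain w where w: "(u, w) \<in> parcs G" "(w, v) \<in> parcs G ^^ k"
      by (meson relpow_Suc_D2)
    then obtain p where "awalk w p v" "length p = k"
      using Suc.IH in_arcsD2 by blast
    then have "awalk u ((u, w) # p) v" using w Suc.prems by (auto simp: awalk_Cons_iff)
    then show ?case using \<open>length p = k\<close> by (metis length_Cons)
  qed
  then show ?thesis using that by blast
qed

lemma graph_dist_le:
  assumes "pair_graph G" "u \<in> pverts G" "(u, v) \<in> parcs G ^^ k"
  shows "graph_dist G u v \<le> ereal (real k)"
proof -
  interpret pair_graph G by fact
  obtain p where p: "awalk u p v" "length p = k" using relpow_imp_awalk[OF assms] .
  have "awalk_cost (\<lambda>_. 1) p = real k" using p(2) by (simp add: awalk_cost_def sum_list_triv)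
  then show ?thesis
    using min_cost_le_walk_cost[OF p(1), of "\<lambda>_. 1"] by (simp add: graph_dist_def)
qed

lemma graph_dist_ge:
  assumes "pair_graph G" "\<And>k. (u, v) \<in> parcs G ^^ k \<Longrightarrow> d \<le> k"
  shows "ereal (real d) \<le> graph_dist G u v"
proof -
  interpret pair_graph G by fact
  show ?thesis unfolding graph_dist_def \<mu>_def
  proof (rule INF_greatest)
    fix p assume "p \<in> {p. awalk u p v}"
    then have "d \<le> length p" using assms(2) awalk_imp_relpow[OF assms(1)] by blast
    then show "ereal (real d) \<le> ereal (awalk_cost (\<lambda>_. 1) p)"
      by (simp add: awalk_cost_def sum_list_triv)
  qed
qed

text \<open>
  The diameter is a supremum of distances. If every distance were smaller than \<open>d\<close>, then every
  distance, and thus the supremum, would be at most \<open>d - 1\<close>.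
\<close>

lemma graph_diameter_attained:
  assumes G: "pair_graph G" and d: "graph_diameter G = ereal (real d)" "0 < d"
  shows "\<exists>a\<in>pverts G. \<exists>b\<in>pverts G. \<forall>k. (a, b) \<in> parcs G ^^ k \<longrightarrow> d \<le> k"
proof (rule ccontr)
  assume "\<not> ?thesis"
  then have *: "\<exists>k<d. (a, b) \<in> parcs G ^^ k" if "a \<in> pverts G" "b \<in> pverts G" for a b
    using that by (meson not_le)
  have "graph_diameter G \<le> ereal (real (d - 1))"
    unfolding graph_diameter_def
  proof (intro SUP_least)
    fix a b assume ab: "a \<in> pverts G" "b \<in> pverts G"
    obtain k where "k < d" "(a, b) \<in> parcs G ^^ k" using *[OF ab] by blast
    then show "graph_dist G a b \<le> ereal (real (d - 1))"
      using graph_dist_le[OF G ab(1)] by (metis Suc_pred' d(2) dual_order.trans ereal_less_eq(3) less_Suc_eq_le of_nat_le_iff)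
  qed
  then show False using d by simp
qed

lemma graph_diameter_eqI:
  assumes G: "pair_graph G"
    and le: "\<And>a b. a \<in> pverts G \<Longrightarrow> b \<in> pverts G \<Longrightarrow> \<exists>k\<le>d. (a, b) \<in> parcs G ^^ k"
    and ge: "a \<in> pverts G" "b \<in> pverts G" "\<And>k. (a, b) \<in> parcs G ^^ k \<Longrightarrow> d \<le> k"
  shows "graph_diameter G = ereal (real d)"
proof (rule antisym)
  show "graph_diameter G \<le> ereal (real d)"
    unfolding graph_diameter_def
  proof (intro SUP_least)
    fix a b assume ab: "a \<in> pverts G" "b \<in> pverts G"
    obtain k where "k \<le> d" "(a, b) \<in> parcs G ^^ k" using le[OF ab] by blast
    then show "graph_dist G a b \<le> ereal (real d)"
      using graph_dist_le[OF G ab(1)] by (meson dual_order.trans ereal_less_eq(3) of_nat_le_iff)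
  qed
  have "ereal (real d) \<le> graph_dist G a b" by (rule graph_dist_ge[OF G ge(3)])
  also have "\<dots> \<le> graph_diameter G"
    unfolding graph_diameter_def using ge(1,2) by (blast intro: SUP_upper2)
  finally show "ereal (real d) \<le> graph_diameter G" .
qed

section \<open>Unicyclic graphs as rooted trees with one extra edge\<close>

text \<open>
  The tree is given by the parent map \<open>par\<close>, and \<open>uv\<close> is the edge outside of it. The level of a
  vertex is the length of its tree path to the root.
\<close>

locale rooted_unicyclic =
  fixes G :: "'a pair_pre_digraph" and r :: 'a and par :: "'a \<Rightarrow> 'a" and lev :: "'a \<Rightarrow> nat"
    and u v :: 'a
  assumes G: "pair_graph G"
    and root: "r \<in> pverts G" "lev r = 0"
    and par: "w \<in> pverts G \<Longrightarrow> w \<noteq> r \<Longrightarrow> par w \<in> pverts G"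
    and lev: "w \<in> pverts G \<Longrightarrow> w \<noteq> r \<Longrightarrow> lev w = Suc (lev (par w))"
    and extra: "u \<in> pverts G" "v \<in> pverts G" "u \<noteq> r" "v \<noteq> r" "u \<noteq> v" "par u \<noteq> v" "par v \<noteq> u"
    and arcs_iff: "(s, t) \<in> parcs G \<longleftrightarrow>
      (s \<in> pverts G \<and> s \<noteq> r \<and> t = par s) \<or> (t \<in> pverts G \<and> t \<noteq> r \<and> s = par t)
      \<or> (s = u \<and> t = v) \<or> (s = v \<and> t = u)"
begin

lemma finite_verts: "finite (pverts G)"
proof -
  interpret pair_graph G by (rule G)
  show ?thesis by (rule pair_finite_verts)
qed

lemma alpha_form_eq:
  "alpha_form \<alpha> G x = (\<Sum>w\<in>pverts G - {r}. edge_form \<alpha> (x w) (x (par w))) + edge_form \<alpha> (x u) (x v)"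
proof -
  interpret pair_graph G by (rule G)
  let ?h = "\<lambda>(s, t). x s * (\<alpha> * x s + (1 - \<alpha>) * x t)"
  define Z where "Z = (\<lambda>w. (w, par w)) ` (pverts G - {r})"
  have fin: "finite Z" unfolding Z_def using finite_verts by simp
  have uv: "(u, v) \<notin> Z" using extra by (auto simp: Z_def)
  define Q where "Q = insert (u, v) Z"
  have parcs_eq: "parcs G = Q \<union> Q\<inverse>"
    by (auto simp: Q_def Z_def arcs_iff)
  have par2: "par (par w) \<noteq> w" if "w \<in> pverts G" "w \<noteq> r" "par w \<noteq> r" for w
    using lev[of w] lev[of "par w"] par[of w] that by auto
  have disj: "Q \<inter> Q\<inverse> = {}"
    using extra by (auto simp: Q_def Z_def) (metis par2)
  have inj: "inj_on prod.swap Q" by (auto simp: inj_on_def)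
  have conv: "Q\<inverse> = prod.swap ` Q" by auto
  have finQ: "finite Q" "finite (Q\<inverse>)" using fin by (auto simp: Q_def)
  have "alpha_form \<alpha> G x = (\<Sum>s\<in>pverts G. \<Sum>t\<in>neighbours G s. ?h (s, t))"
    unfolding alpha_form_def alpha_op_def by (simp only: sum_distrib_left prod.case)
  also have "\<dots> = (\<Sum>e\<in>Sigma (pverts G) (neighbours G). ?h e)"
    using finite_verts neighbours_subset(2)[OF G] by (subst sum.Sigma) auto
  also have "Sigma (pverts G) (neighbours G) = Q \<union> Q\<inverse>"
    unfolding parcs_eq[symmetric] by (auto simp: neighbours_def dest: in_arcsD1)
  also have "(\<Sum>e\<in>Q \<union> Q\<inverse>. ?h e) = (\<Sum>e\<in>Q. ?h e) + (\<Sum>e\<in>Q\<inverse>. ?h e)"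
    by (rule sum.union_disjoint[OF finQ disj])
  also have "(\<Sum>e\<in>Q\<inverse>. ?h e) = (\<Sum>e\<in>Q. ?h (prod.swap e))"
    unfolding conv by (subst sum.reindex[OF inj]) simp
  also have "(\<Sum>e\<in>Q. ?h e) + (\<Sum>e\<in>Q. ?h (prod.swap e)) = (\<Sum>(s, t)\<in>Q. edge_form \<alpha> (x s) (x t))"
    unfolding sum.distrib[symmetric]
    by (intro sum.cong refl) (auto simp: edge_form_def algebra_simps power2_eq_square)
  also have "\<dots> = edge_form \<alpha> (x u) (x v) + (\<Sum>(s, t)\<in>Z. edge_form \<alpha> (x s) (x t))"
    unfolding Q_def using fin uv by simp
  also have "(\<Sum>(s, t)\<in>Z. edge_form \<alpha> (x s) (x t)) = (\<Sum>w\<in>pverts G - {r}. edge_form \<alpha> (x w) (x (par w)))"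
    unfolding Z_def by (subst sum.reindex) (auto simp: inj_on_def)
  finally show ?thesis by simp
qed

end

text \<open>
  A breadth-first search tree from \<open>m\<close> uses one edge for each vertex other than \<open>m\<close>, so in a unicyclic
  graph one edge is left over. All the edges at \<open>m\<close> belong to the tree, so the remaining one avoids
  \<open>m\<close>. The second conclusion records that the levels are distances from \<open>m\<close>.
\<close>

lemma unicyclic_rooted:
  fixes G :: "'a pair_pre_digraph"
  assumes "unicyclic G" and m: "m \<in> pverts G"
  obtains par lev u v where "rooted_unicyclic G m par lev u v"
    "\<And>s t. (s, t) \<in> parcs G \<Longrightarrow> lev t \<le> Suc (lev s)"
proof -
  have G: "pair_graph G" and conn: "Digraph_Component.connected (with_proj G)"
    and card: "card (undirected_edges G) = card (pverts G)"
    using assms(1) by (auto simp: unicyclic_def)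
  interpret pair_graph G by (rule G)
  note wf = in_arcsD1 in_arcsD2
  let ?V = "pverts G"
  have fin: "finite ?V" by (rule pair_finite_verts)
  \<comment> \<open>the distance from \<open>m\<close>\<close>
  define lev where "lev w = (LEAST k. (m, w) \<in> parcs G ^^ k)" for w
  have walk: "(m, w) \<in> parcs G ^^ lev w" if "w \<in> ?V" for w
    unfolding lev_def
    using connected_imp_rtrancl[OF G conn m that] by (metis LeastI_ex rtrancl_imp_relpow)
  have lev_le: "lev w \<le> k" if "(m, w) \<in> parcs G ^^ k" for w k
    unfolding lev_def using that by (rule Least_le)
  have lev_arc: "lev t \<le> Suc (lev s)" if "(s, t) \<in> parcs G" for s t
    using walk[of s] wf(1)[OF that] that by (intro lev_le) auto
  have lev0: "w = m" if "w \<in> ?V" "lev w = 0" for w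
    using walk[OF that(1)] that(2) by simp
  have levm: "lev m = 0" using lev_le[of m 0] by simp
  have "\<exists>p. (p, w) \<in> parcs G \<and> lev w = Suc (lev p)" if w: "w \<in> ?V" "w \<noteq> m" for w
  proof -
    obtain k where k: "lev w = Suc k" using lev0[OF w(1)] w(2) not0_implies_Suc by blast
    then obtain p where p: "(m, p) \<in> parcs G ^^ k" "(p, w) \<in> parcs G"
      using walk[OF w(1)] by auto
    then show ?thesis using lev_le[OF p(1)] lev_arc[OF p(2)] k by (intro exI[of _ p]) auto
  qed
  then obtain par where par: "\<And>w. w \<in> ?V \<Longrightarrow> w \<noteq> m \<Longrightarrow> (par w, w) \<in> parcs G"
    "\<And>w. w \<in> ?V \<Longrightarrow> w \<noteq> m \<Longrightarrow> lev w = Suc (lev (par w))"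
    by metis
  define T where "T = (\<lambda>w. {w, par w}) ` (?V - {m})"
  have "inj_on (\<lambda>w. {w, par w}) (?V - {m})"
  proof (rule inj_onI)
    fix w w' assume w: "w \<in> ?V - {m}" "w' \<in> ?V - {m}" "{w, par w} = {w', par w'}"
    show "w = w'"
    proof (rule ccontr)
      assume "w \<noteq> w'"
      then have "w = par w'" "w' = par w" using w(3) by (auto simp: doubleton_eq_iff)
      then show False using par(2)[of w] par(2)[of w'] w by auto
    qed
  qed
  then have cT: "card T = card ?V - 1"
    unfolding T_def using fin m by (simp add: card_image)
  have Tsub: "T \<subseteq> undirected_edges G"
    using par(1) by (auto simp: T_def undirected_edges_def insert_commute)
  have "undirected_edges G \<subseteq> Pow ?V" using wf by (auto simp: undirected_edges_def)
  then have finE: "finite (undirected_edges G)" using fin by (metis finite_Pow_iff finite_subset)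
  have "0 < card ?V" using fin m by (auto simp: card_gt_0_iff)
  then have "card (undirected_edges G - T) = 1"
    using cT card Tsub finE by (subst card_Diff_subset) (auto intro: finite_subset)
  then obtain e where e: "undirected_edges G - T = {e}" by (auto simp: card_1_singleton_iff)
  then have "e \<in> undirected_edges G" by blast
  then obtain u v where uv: "e = {u, v}" "(u, v) \<in> parcs G"
    by (auto simp: undirected_edges_def)
  have uvT: "{u, v} \<notin> T" using e uv(1) by blast
  have nm: "t \<noteq> m" if "(s, t) \<in> parcs G" "{s, t} \<notin> T" for s t
  proof
    assume [simp]: "t = m"
    have s: "s \<in> ?V" "s \<noteq> m" using wf(1)[OF that(1)] pair_no_loops[OF that(1)] by auto
    have "lev s \<le> 1" using lev_arc[OF parcs_sym[OF G that(1)]] levm by simp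
    then have "lev (par s) = 0" using par(2)[OF s] by simp
    then have "par s = m" using lev0[OF wf(1)[OF par(1)[OF s]]] by simp
    then show False using that(2) s by (auto simp: T_def)
  qed
  have vu: "(v, u) \<in> parcs G" by (rule parcs_sym[OF G uv(2)])
  have neq: "u \<noteq> m" "v \<noteq> m" using nm[OF uv(2) uvT] nm[OF vu] uvT by (auto simp: insert_commute)
  have inV: "u \<in> ?V" "v \<in> ?V" using wf[OF uv(2)] by auto
  have "(s, t) \<in> parcs G \<longleftrightarrow> (s \<in> ?V \<and> s \<noteq> m \<and> t = par s) \<or> (t \<in> ?V \<and> t \<noteq> m \<and> s = par t)
      \<or> (s = u \<and> t = v) \<or> (s = v \<and> t = u)" (is "?L \<longleftrightarrow> ?R") for s t
  proof
    assume ?L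
    then have "{s, t} \<in> undirected_edges G" by (auto simp: undirected_edges_def)
    then have "{s, t} \<notin> T \<Longrightarrow> {s, t} \<in> undirected_edges G - T" by (rule DiffI)
    then have "{s, t} \<notin> T \<Longrightarrow> {s, t} = {u, v}" unfolding e uv(1) by (rule singletonD)
    then consider w where "w \<in> ?V" "w \<noteq> m" "{s, t} = {w, par w}" | "{s, t} = {u, v}"
      unfolding T_def by (metis (lifting) DiffE imageE singletonI)
    then show ?R by cases (simp_all add: doubleton_eq_iff, metis+)
  next
    assume ?R
    then show ?L using par(1) parcs_sym[OF G] uv(2) vu by auto
  qed
  moreover have "u \<noteq> v" using pair_no_loops[OF uv(2)] by simp
  moreover have "par u \<noteq> v" "par v \<noteq> u" using uvT inV neq by (auto simp: T_def insert_commute)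
  ultimately have "rooted_unicyclic G m par lev u v"
    using G m levm par wf(1)[OF par(1)] neq inV by unfold_locales auto
  then show ?thesis using that lev_arc by blast
qed

lemma relpow_parcs_sym:
  assumes "pair_graph G" "(u, v) \<in> parcs G ^^ k"
  shows "(v, u) \<in> parcs G ^^ k"
  using assms(2)
proof (induction k arbitrary: v)
  case 0
  then show ?case by simp
next
  case (Suc k)
  then obtain w where "(u, w) \<in> parcs G ^^ k" "(w, v) \<in> parcs G" by auto
  then show ?case using Suc.IH parcs_sym[OF assms(1)] by (meson relpow_Suc_I2)
qed

context rooted_unicyclic
begin

lemma walk_to_root: "w \<in> pverts G \<Longrightarrow> (w, r) \<in> parcs G ^^ lev w"
proof (induction "lev w" arbitrary: w rule: less_induct)
  case less
  show ?case
  proof (cases "w = r")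
    case True
    then show ?thesis using root by simp
  next
    case False
    note l = lev[OF less.prems False] and p = par[OF less.prems False]
    have "(w, par w) \<in> parcs G" using less.prems False arcs_iff by blast
    moreover have "(par w, r) \<in> parcs G ^^ lev (par w)" using less.hyps[OF _ p] l by simp
    ultimately show ?thesis unfolding l by (rule relpow_Suc_I2)
  qed
qed

lemma card_edges: "card (undirected_edges G) = card (pverts G)"
proof -
  let ?e = "\<lambda>w. {w, par w}"
  have E: "undirected_edges G = insert {u, v} (?e ` (pverts G - {r}))"
  proof
    show "undirected_edges G \<subseteq> insert {u, v} (?e ` (pverts G - {r}))"
      unfolding undirected_edges_def arcs_iff by auto
    show "insert {u, v} (?e ` (pverts G - {r})) \<subseteq> undirected_edges G"
      unfolding undirected_edges_def arcs_iff by auto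
  qed
  have par2: "\<not> (w = par w' \<and> w' = par w)" if "w \<in> pverts G - {r}" "w' \<in> pverts G - {r}" for w w'
    using lev[of w] lev[of w'] that by auto
  have "inj_on ?e (pverts G - {r})"
  proof (rule inj_onI)
    fix w w' assume "w \<in> pverts G - {r}" "w' \<in> pverts G - {r}" "?e w = ?e w'"
    then show "w = w'" using par2[of w w'] by (auto simp: doubleton_eq_iff)
  qed
  moreover have "{u, v} \<notin> ?e ` (pverts G - {r})"
    using extra by (auto simp: doubleton_eq_iff)
  moreover have "0 < card (pverts G)" using finite_verts root by (auto simp: card_gt_0_iff)
  ultimately show ?thesis
    unfolding E using finite_verts root by (simp add: card_image)
qed

lemma is_unicyclic: "unicyclic G"
proof -
  interpret pair_graph G by (rule G)
  have "s \<rightarrow>\<^sup>*\<^bsub>with_proj G\<^esub> t" if s: "s \<in> pverts G" and t: "t \<in> pverts G" for s t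
  proof -
    have "(s, r) \<in> parcs G ^^ lev s" by (rule walk_to_root[OF s])
    moreover have "(r, t) \<in> parcs G ^^ lev t"
      by (rule relpow_parcs_sym[OF G walk_to_root[OF t]])
    ultimately have "(s, t) \<in> parcs G ^^ (lev s + lev t)" by (auto simp: relpow_add)
    then obtain p where "awalk s p t" using relpow_imp_awalk[OF G s] by blast
    then show ?thesis by (auto simp: reachable_awalk)
  qed
  then have "Digraph_Component.connected (with_proj G)"
    using root reachable_mk_symmetric_eq[OF pair_sym_arcs]
    by (auto simp: Digraph_Component.connected_def strongly_connected_def)
  then show ?thesis using G card_edges by (simp add: unicyclic_def)
qed

lemma neighbours_eq:
  assumes "s \<in> pverts G"
  shows "neighbours G s = (if s = r then {} else {par s}) \<union> {t \<in> pverts G - {r}. par t = s}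
    \<union> (if s = u then {v} else {}) \<union> (if s = v then {u} else {})"
  using assms by (auto simp: neighbours_def arcs_iff)

end

section \<open>A rearrangement inequality\<close>

lemma sum_le_sum_initial:
  fixes z :: "nat \<Rightarrow> real"
  assumes "antimono z" "finite S"
  shows "sum z S \<le> (\<Sum>k<card S. z k)"
  using assms(2)
proof (induction "card S" arbitrary: S)
  case 0
  then show ?case by simp
next
  case (Suc n)
  define t where "t = Max S"
  have ne: "S \<noteq> {}" using Suc.hyps(2) by auto
  have t: "t \<in> S" using ne Suc.prems by (simp add: t_def)
  have "S \<subseteq> {..t}" using Suc.prems by (auto simp: t_def)
  then have "Suc n \<le> Suc t" using card_mono[of "{..t}" S] Suc.hyps(2) by simp
  then have "z t \<le> z n" using assms(1) by (simp add: antimono_def)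
  moreover have "n = card (S - {t})" using Suc.hyps(2) Suc.prems t by simp
  from Suc.hyps(1)[OF this] Suc.prems have "sum z (S - {t}) \<le> (\<Sum>k<n. z k)"
    unfolding \<open>n = card (S - {t})\<close>[symmetric] by simp
  moreover have "sum z S = z t + sum z (S - {t})" using t Suc.prems by (simp add: sum.remove)
  ultimately show ?case by (simp flip: Suc.hyps(2))
qed

text \<open>
  Summation by parts: a partial sum of the products is bounded below by the next weight times the
  partial sum of \<open>w\<close>.
\<close>

lemma weighted_sum_nonneg:
  fixes y w :: "nat \<Rightarrow> real"
  assumes y: "antimono y" "\<And>k. 0 \<le> y k"
    and w: "\<And>l. l \<le> d \<Longrightarrow> 0 \<le> (\<Sum>k<l. w k)"
  shows "0 \<le> (\<Sum>k<d. y k * w k)"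
proof -
  have "y l * (\<Sum>k<l. w k) \<le> (\<Sum>k<l. y k * w k)" if "l \<le> d" for l
    using that
  proof (induction l)
    case 0
    then show ?case by simp
  next
    case (Suc l)
    have "y (Suc l) * (\<Sum>k<Suc l. w k) \<le> y l * (\<Sum>k<Suc l. w k)"
      using y(1) w[OF Suc.prems] by (intro mult_right_mono) (auto simp: antimono_def)
    also have "\<dots> \<le> (\<Sum>k<Suc l. y k * w k)"
      using Suc by (simp add: distrib_left)
    finally show ?case .
  qed
  from this[of d] show ?thesis using y(2)[of d] w[of d]
    by (meson mult_nonneg_nonneg order.trans order_refl)
qed

text \<open>
  Here \<open>y\<close> lists the values of children and \<open>z\<close> the values that are available for their parents, each
  to be used at most once. Matching in decreasing order is optimal: any \<open>l\<close> of the values \<open>z\<close> or of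
  their squares sum up to at most the sum of the first \<open>l\<close>, and the mixed terms follow by summation by
  parts.
\<close>

lemma edge_form_rearrangement:
  fixes y z :: "nat \<Rightarrow> real"
  assumes \<alpha>: "0 \<le> \<alpha>" "\<alpha> < 1"
    and y: "antimono y" "\<And>k. 0 \<le> y k"
    and z: "antimono z" "\<And>k. 0 \<le> z k"
    and p: "inj_on p {..<d}"
  shows "(\<Sum>k<d. edge_form \<alpha> (y k) (z (p k))) \<le> (\<Sum>k<d. edge_form \<alpha> (y k) (z k))"
proof -
  have prefix: "(\<Sum>k<l. g (p k)) \<le> (\<Sum>k<l. g k)" if g: "antimono g" and l: "l \<le> d" for g :: "nat \<Rightarrow> real" and l
  proof -
    have inj: "inj_on p {..<l}" using l by (intro inj_on_subset[OF p]) auto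
    have "(\<Sum>k<l. g (p k)) = sum g (p ` {..<l})" by (simp add: sum.reindex[OF inj])
    also have "\<dots> \<le> (\<Sum>k<l. g k)"
      using sum_le_sum_initial[OF g, of "p ` {..<l}"] by (simp add: card_image[OF inj])
    finally show ?thesis .
  qed
  have z2: "antimono (\<lambda>k. (z k)\<^sup>2)"
    using z by (auto simp: antimono_def intro!: power_mono)
  have "0 \<le> (\<Sum>k<d. y k * (z k - z (p k)))"
    using prefix[OF z(1)] by (intro weighted_sum_nonneg y) (simp add: sum_subtractf)
  then have "(\<Sum>k<d. y k * z (p k)) \<le> (\<Sum>k<d. y k * z k)"
    by (simp add: right_diff_distrib sum_subtractf)
  then have b: "2 * (1 - \<alpha>) * (\<Sum>k<d. y k * z (p k)) \<le> 2 * (1 - \<alpha>) * (\<Sum>k<d. y k * z k)"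
    using \<alpha> by (intro mult_left_mono) auto
  have a: "\<alpha> * (\<Sum>k<d. (z (p k))\<^sup>2) \<le> \<alpha> * (\<Sum>k<d. (z k)\<^sup>2)"
    using prefix[OF z2 order_refl] \<alpha> by (intro mult_left_mono) auto
  have e: "(\<Sum>k<d. edge_form \<alpha> (y k) (f k))
      = \<alpha> * (\<Sum>k<d. (y k)\<^sup>2) + \<alpha> * (\<Sum>k<d. (f k)\<^sup>2) + 2 * (1 - \<alpha>) * (\<Sum>k<d. y k * f k)" for f
    by (simp add: edge_form_def sum.distrib sum_distrib_left distrib_left mult.assoc)
  show ?thesis unfolding e using a b by linarith
qed

section \<open>The graphs \<open>Delta2\<close>\<close>

text \<open>
  Removing the edge \<open>W1 W3\<close> leaves a tree, which is rooted at \<open>W2\<close> here.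
\<close>

fun Delta2_parent :: "delta_vertex \<Rightarrow> delta_vertex" where
  "Delta2_parent (PathA k) = (if k \<le> 1 then W2 else PathA (k - 1))"
| "Delta2_parent (PathB k) = (if k \<le> 1 then W3 else PathB (k - 1))"
| "Delta2_parent _ = W2"

fun Delta2_level :: "delta_vertex \<Rightarrow> nat" where
  "Delta2_level W2 = 0"
| "Delta2_level (PathA k) = k"
| "Delta2_level (PathB k) = Suc k"
| "Delta2_level _ = 1"

lemma in_pverts_Delta2 [simp]:
  "W1 \<in> pverts (Delta2 s a b)" "W2 \<in> pverts (Delta2 s a b)" "W3 \<in> pverts (Delta2 s a b)"
  "Pendant k \<in> pverts (Delta2 s a b) \<longleftrightarrow> 1 \<le> k \<and> k \<le> s"
  "PathA k \<in> pverts (Delta2 s a b) \<longleftrightarrow> 1 \<le> k \<and> k \<le> a"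
  "PathB k \<in> pverts (Delta2 s a b) \<longleftrightarrow> 1 \<le> k \<and> k \<le> b"
  by (auto simp: Delta2_def)

lemma parcs_Delta2_iff:
  "(p, q) \<in> parcs (Delta2 s a b) \<longleftrightarrow>
     (p \<in> pverts (Delta2 s a b) \<and> p \<noteq> W2 \<and> q = Delta2_parent p)
     \<or> (q \<in> pverts (Delta2 s a b) \<and> q \<noteq> W2 \<and> p = Delta2_parent q)
     \<or> (p = W3 \<and> q = W1) \<or> (p = W1 \<and> q = W3)"
proof -
  have links: "(p, q) \<in> Delta2_links s a b \<longleftrightarrow>
      (q \<in> pverts (Delta2 s a b) \<and> q \<noteq> W2 \<and> q \<noteq> W1 \<and> p = Delta2_parent q)
      \<or> (p = W1 \<and> q = W2) \<or> (p = W3 \<and> q = W1)" for p q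
    by (cases p; cases q) (auto simp: Delta2_links_def)
  have "(p, q) \<in> parcs (Delta2 s a b) \<longleftrightarrow>
      (p, q) \<in> Delta2_links s a b \<or> (q, p) \<in> Delta2_links s a b"
    by (simp add: Delta2_def)
  then show ?thesis
    unfolding links by (cases "p = W1"; cases "q = W1") auto
qed

lemma Delta2_rooted: "rooted_unicyclic (Delta2 s a b) W2 Delta2_parent Delta2_level W3 W1"
proof -
  let ?G = "Delta2 s a b"
  have finV: "finite (pverts ?G)" by (simp add: Delta2_def)
  have par: "Delta2_parent p \<in> pverts ?G" if "p \<in> pverts ?G" for p
    using that by (cases p) auto
  have lev: "Delta2_level p = Suc (Delta2_level (Delta2_parent p))" if "p \<in> pverts ?G" "p \<noteq> W2" for p
    using that by (cases p) auto
  have ends: "p \<in> pverts ?G \<and> q \<in> pverts ?G" if "(p, q) \<in> parcs ?G" for p q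
    using that unfolding parcs_Delta2_iff using par by auto
  have "parcs ?G \<subseteq> pverts ?G \<times> pverts ?G" using ends by auto
  then have finE: "finite (parcs ?G)" using finV by (meson finite_SigmaI finite_subset)
  have loop: "p \<noteq> q" if "(p, q) \<in> parcs ?G" for p q
    using that lev[of p] unfolding parcs_Delta2_iff
    by (metis delta_vertex.distinct(3) n_not_Suc_n)
  have "sym (parcs ?G)" by (auto simp: sym_def parcs_Delta2_iff)
  then have sym: "symmetric (with_proj ?G)" by (simp add: symmetric_def)
  have "pair_graph ?G"
    using finV finE ends loop sym by unfold_locales auto
  then show ?thesis
  proof (rule rooted_unicyclic.intro)
    show "Delta2_level p = Suc (Delta2_level (Delta2_parent p))" if "p \<in> pverts ?G" "p \<noteq> W2" for p
      by (rule lev[OF that])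
  qed (use par in \<open>auto simp: parcs_Delta2_iff\<close>)
qed

text \<open>
  Every vertex is within \<open>a\<close> steps of \<open>W2\<close> or within \<open>b\<close> steps of \<open>W3\<close>, which bounds the diameter
  from above because \<open>2 a\<close> and \<open>2 b\<close> are at most \<open>a + b + 1\<close>.
\<close>

lemma diameter_Delta2:
  assumes "1 \<le> a" "b \<le> a" "a \<le> b + 1"
  shows "graph_diameter (Delta2 s a b) = ereal (real (a + b + 1))"
proof -
  let ?G = "Delta2 s a b"
  let ?R = "parcs ?G"
  interpret rooted_unicyclic ?G W2 Delta2_parent Delta2_level W3 W1 by (rule Delta2_rooted)
  have pathB: "(PathB k, W3) \<in> ?R ^^ k" if "1 \<le> k" "k \<le> b" for k
    using that
  proof (induction k)
    case 0
    then show ?case by simp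
  next
    case (Suc k)
    have arc: "(PathB (Suc k), Delta2_parent (PathB (Suc k))) \<in> ?R"
      using Suc.prems unfolding parcs_Delta2_iff by auto
    show ?case
    proof (cases "k = 0")
      case True
      then show ?thesis using arc by simp
    next
      case False
      then have "(PathB k, W3) \<in> ?R ^^ k" using Suc by simp
      then show ?thesis using arc False by (intro relpow_Suc_I2[of _ "PathB k"]) auto
    qed
  qed
  have near: "(\<exists>k\<le>a. (p, W2) \<in> ?R ^^ k) \<or> (\<exists>k\<le>b. (p, W3) \<in> ?R ^^ k)" if p: "p \<in> pverts ?G" for p
  proof (cases "p = W3 \<or> (\<exists>k. p = PathB k)")
    case True
    moreover have "(W3, W3) \<in> ?R ^^ 0" by simp
    ultimately show ?thesis using pathB p by (metis in_pverts_Delta2(6) zero_le)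
  next
    case False
    then have "Delta2_level p \<le> a" using p assms(1) by (cases p) auto
    then show ?thesis using walk_to_root[OF p] by blast
  qed
  have W23: "(W2, W3) \<in> ?R" "(W3, W2) \<in> ?R" by (auto simp: parcs_Delta2_iff)
  have join: "(p, q) \<in> ?R ^^ (k + l)" if "(p, w) \<in> ?R ^^ k" "(q, w) \<in> ?R ^^ l" for p q w k l
    using that relpow_parcs_sym[OF G that(2)] by (auto simp: relpow_add)
  show ?thesis
  proof (rule graph_diameter_eqI[OF G])
    fix p q assume p: "p \<in> pverts ?G" and q: "q \<in> pverts ?G"
    consider (AA) k l where "k \<le> a" "(p, W2) \<in> ?R ^^ k" "l \<le> a" "(q, W2) \<in> ?R ^^ l"
      | (BB) k l where "k \<le> b" "(p, W3) \<in> ?R ^^ k" "l \<le> b" "(q, W3) \<in> ?R ^^ l"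
      | (AB) k l where "k \<le> a" "(p, W2) \<in> ?R ^^ k" "l \<le> b" "(q, W3) \<in> ?R ^^ l"
      | (BA) k l where "k \<le> b" "(p, W3) \<in> ?R ^^ k" "l \<le> a" "(q, W2) \<in> ?R ^^ l"
      using near[OF p] near[OF q] by blast
    then show "\<exists>k\<le>a + b + 1. (p, q) \<in> ?R ^^ k"
    proof cases
      case AA
      then show ?thesis using join[OF AA(2,4)] assms by (intro exI[of _ "k + l"]) auto
    next
      case BB
      then show ?thesis using join[OF BB(2,4)] assms by (intro exI[of _ "k + l"]) auto
    next
      case AB
      have "(p, W3) \<in> ?R ^^ Suc k" using AB(2) W23(1) by auto
      from join[OF this AB(4)] show ?thesis using AB by (intro exI[of _ "Suc k + l"]) auto
    next
      case BA
      have "(p, W2) \<in> ?R ^^ Suc k" using BA(2) W23(2) by auto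
      from join[OF this BA(4)] show ?thesis using BA by (intro exI[of _ "Suc k + l"]) auto
    qed
  next
    define far where "far = (if b = 0 then W3 else PathB b)"
    show "PathA a \<in> pverts ?G" "far \<in> pverts ?G" using assms(1) by (auto simp: far_def)
    \<comment> \<open>a potential that changes by at most one along an arc, so the ends of the two paths are far apart\<close>
    define h where "h p = (case p of W3 \<Rightarrow> 1 | PathA k \<Rightarrow> - int k | PathB k \<Rightarrow> int k + 1 | _ \<Rightarrow> 0)" for p
    have par1: "\<bar>h p - h (Delta2_parent p)\<bar> \<le> 1" if "p \<in> pverts ?G" for p
      using that by (cases p) (auto simp: h_def)
    have step: "h q \<le> h p + 1" if "(p, q) \<in> ?R" for p q
    proof -
      have "\<bar>h W3 - h W1\<bar> \<le> 1" by (simp add: h_def)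
      then show ?thesis using that par1[of p] par1[of q] unfolding parcs_Delta2_iff by auto
    qed
    fix k assume "(PathA a, far) \<in> ?R ^^ k"
    moreover have "h q \<le> h p + int k" if "(p, q) \<in> ?R ^^ k" for p q k
      using that
    proof (induction k arbitrary: q)
      case 0
      then show ?case by simp
    next
      case (Suc k)
      then obtain w where "(p, w) \<in> ?R ^^ k" "(w, q) \<in> ?R" by auto
      then show ?case using Suc.IH[of w] step[of w q] by simp
    qed
    ultimately have "h far \<le> h (PathA a) + int k" by blast
    then show "a + b + 1 \<le> k" by (auto simp: h_def far_def split: if_splits)
  qed
qed

lemma card_pverts_Delta2: "card (pverts (Delta2 s a b)) = s + a + b + 3"
proof -
  have "pverts (Delta2 s a b)
      = {W1, W2, W3} \<union> (Pendant ` {1..s} \<union> (PathA ` {1..a} \<union> PathB ` {1..b}))"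
    by (auto simp: Delta2_def)
  also have "card \<dots> = card {W1, W2, W3}
      + (card (Pendant ` {1..s}) + (card (PathA ` {1..a}) + card (PathB ` {1..b})))"
    by (subst card_Un_disjoint, force, force, force)+ simp
  also have "\<dots> = s + a + b + 3" by (simp add: card_image inj_on_def)
  finally show ?thesis .
qed

lemma U2_star_in_unicyclic_graphs:
  assumes "2 \<le> d" "d + 2 \<le> n"
  shows "U2_star n d \<in> unicyclic_graphs n d"
proof -
  define a where "a = d div 2"
  define b where "b = (d - 1) div 2"
  define s where "s = n - d - 2"
  have ab: "a + b + 1 = d" "1 \<le> a" "b \<le> a" "a \<le> b + 1"
    using assms(1) unfolding a_def b_def by presburger+
  have U: "U2_star n d = Delta2 s a b"
    unfolding a_def b_def s_def using assms by (intro U2_star_eq) auto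
  have "graph_diameter (Delta2 s a b) = ereal (real d)"
    using diameter_Delta2[OF ab(2-4), of s] unfolding ab(1) .
  moreover have "card (pverts (Delta2 s a b)) = n"
    unfolding card_pverts_Delta2 using ab(1) assms(2) by (simp add: s_def)
  moreover have "unicyclic (Delta2 s a b)"
    by (rule rooted_unicyclic.is_unicyclic[OF Delta2_rooted])
  ultimately show ?thesis unfolding U by (simp add: unicyclic_graphs_def)
qed

section \<open>Placing a vector on the extremal graph\<close>

text \<open>
  The spine of the extremal graph consists of \<open>W3\<close> and the two paths. Its vertices are numbered
  alternately, \<open>W3\<close>, \<open>PathA 1\<close>, \<open>PathB 1\<close>, \<open>PathA 2\<close>, \<dots>, so that the parent of vertex \<open>k\<close> is vertex
  \<open>k - 2\<close>, or the root for the first two.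
\<close>

definition spine_parent :: "'a \<Rightarrow> 'a list \<Rightarrow> nat \<Rightarrow> 'a" where
  "spine_parent r ys k = (if k < 2 then r else ys ! (k - 2))"

fun place :: "'a \<Rightarrow> 'a \<Rightarrow> 'a list \<Rightarrow> 'a list \<Rightarrow> delta_vertex \<Rightarrow> 'a" where
  "place r v ys zs W1 = v"
| "place r v ys zs W2 = r"
| "place r v ys zs W3 = ys ! 0"
| "place r v ys zs (Pendant k) = zs ! (k - 1)"
| "place r v ys zs (PathA k) = ys ! (2 * k - 1)"
| "place r v ys zs (PathB k) = ys ! (2 * k)"

fun spine_index :: "delta_vertex \<Rightarrow> nat" where
  "spine_index (PathA k) = 2 * k - 1"
| "spine_index (PathB k) = 2 * k"
| "spine_index _ = 0"

lemma Delta2_parent_eq_iff: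
  "Delta2_parent p = W1 \<longleftrightarrow> False" "W1 = Delta2_parent p \<longleftrightarrow> False"
  "Delta2_parent p = W3 \<longleftrightarrow> p = PathB 0 \<or> p = PathB 1"
  "W3 = Delta2_parent p \<longleftrightarrow> p = PathB 0 \<or> p = PathB 1"
  "Delta2_parent p = Pendant k \<longleftrightarrow> False" "Pendant k = Delta2_parent p \<longleftrightarrow> False"
  "Delta2_parent p = PathA k \<longleftrightarrow> 1 \<le> k \<and> p = PathA (Suc k)"
  "PathA k = Delta2_parent p \<longleftrightarrow> 1 \<le> k \<and> p = PathA (Suc k)"
  by (cases p; auto simp: le_Suc_eq)+

text \<open>
  A bijection from the extremal graph to a set \<open>V\<close>, given by the images \<open>r\<close> of \<open>W2\<close> and \<open>v\<close> of \<open>W1\<close>, by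
  the images \<open>ys\<close> of the spine in its numbering, and by the images \<open>zs\<close> of the pendant vertices.
\<close>

locale placement =
  fixes V :: "'a set" and r v :: 'a and ys zs :: "'a list" and s a b d :: nat
  assumes ab: "a = d div 2" "b = (d - 1) div 2" and d: "2 \<le> d"
    and ys: "distinct ys" "length ys = d"
    and zs: "distinct zs" "length zs = s"
    and r: "r \<in> V" "r \<notin> set ys" "r \<notin> set zs" "r \<noteq> v"
    and v: "v \<notin> set ys" "v \<notin> set zs"
    and V: "V = {r, v} \<union> set ys \<union> set zs" and disj: "set ys \<inter> set zs = {}"
begin

abbreviation "D \<equiv> Delta2 s a b"
abbreviation "pl \<equiv> place r v ys zs"

definition spine :: "delta_vertex set" where
  "spine = insert W3 (PathA ` {1..a} \<union> PathB ` {1..b})"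

lemma d_eq: "d = a + b + 1"
  unfolding ab using d by presburger

lemma bij_spine: "bij_betw spine_index spine {..<d}"
proof -
  have inj: "inj_on spine_index spine"
    unfolding inj_on_def spine_def by (auto, presburger+)
  have "card spine = d"
    unfolding spine_def
    by (subst card_insert_disjoint, simp, force, subst card_Un_disjoint)
      (auto simp: card_image inj_on_def d_eq)
  moreover have "spine_index ` spine \<subseteq> {..<d}"
    unfolding spine_def using d by (auto simp: ab)
  ultimately have "spine_index ` spine = {..<d}"
    using card_subset_eq[of "{..<d}" "spine_index ` spine"] card_image[OF inj] by simp
  then show ?thesis using inj by (simp add: bij_betw_def)
qed

lemma pverts_D: "pverts D - {W2} = spine \<union> ({W1} \<union> Pendant ` {1..s})"
  by (auto simp: Delta2_def spine_def)

lemma place_spine: "p \<in> spine \<Longrightarrow> pl p = ys ! spine_index p"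
  by (auto simp: spine_def)

lemma place_parent_spine: "p \<in> spine \<Longrightarrow> pl (Delta2_parent p) = spine_parent r ys (spine_index p)"
  by (auto simp: spine_def spine_parent_def diff_mult_distrib2 numeral_2_eq_2)

lemma bij_place_spine: "bij_betw pl spine (set ys)"
proof -
  have "bij_betw ((!) ys \<circ> spine_index) spine (set ys)"
    by (rule bij_betw_trans[OF bij_spine]) (metis bij_betw_nth lessThan_atLeast0 ys)
  then show ?thesis by (rule iffD1[OF bij_betw_cong, rotated]) (simp add: place_spine)
qed

lemma bij_place_rest: "bij_betw pl ({W1} \<union> Pendant ` {1..s}) (insert v (set zs))"
proof -
  have "bij_betw pl (Pendant ` {1..s}) (set zs)"
  proof -
    have "inj_on pl (Pendant ` {1..s})"
      using zs by (auto simp: inj_on_def nth_eq_iff_index_eq)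
    moreover have "pl ` Pendant ` {1..s} = set zs"
    proof -
      have "w \<in> pl ` Pendant ` {1..s}" if "w \<in> set zs" for w
      proof -
        obtain k where "k < s" "w = zs ! k" using \<open>w \<in> set zs\<close> zs by (auto simp: in_set_conv_nth)
        then show ?thesis by (intro image_eqI[of _ _ "Pendant (Suc k)"]) auto
      qed
      then show ?thesis using zs by auto
    qed
    ultimately show ?thesis by (simp add: bij_betw_def)
  qed
  moreover have "bij_betw pl {W1} {v}" by (simp add: bij_betw_def)
  ultimately show ?thesis
    using v bij_betw_combine[of pl "{W1}" "{v}" "Pendant ` {1..s}" "set zs"] by simp
qed

lemma bij_place_nonroot: "bij_betw pl (pverts D - {W2}) (V - {r})"
proof -
  have "V - {r} = set ys \<union> insert v (set zs)" using V r by auto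
  moreover have "set ys \<inter> insert v (set zs) = {}" using v disj by auto
  ultimately show ?thesis
    unfolding pverts_D using bij_betw_combine[OF bij_place_spine bij_place_rest] by simp
qed

lemma bij_place: "bij_betw pl (pverts D) V"
proof -
  have "bij_betw pl ({W2} \<union> (pverts D - {W2})) ({r} \<union> (V - {r}))"
    by (rule bij_betw_combine[OF _ bij_place_nonroot]) (auto simp: bij_betw_def)
  then show ?thesis using r(1) by (simp add: insert_absorb)
qed

lemma sqnorm_place: "sqnorm D (x \<circ> pl) = (\<Sum>w\<in>V. (x w)\<^sup>2)"
  using sum.reindex_bij_betw[OF bij_place, of "\<lambda>w. (x w)\<^sup>2"] by (simp add: sqnorm_def)

lemma alpha_form_place:
  "alpha_form \<alpha> D (x \<circ> pl) =
     (\<Sum>k<d. edge_form \<alpha> (x (ys ! k)) (x (spine_parent r ys k)))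
     + (\<Sum>w\<in>V - {r} - set ys. edge_form \<alpha> (x w) (x r)) + edge_form \<alpha> (x (ys ! 0)) (x v)"
proof -
  let ?f = "\<lambda>p. edge_form \<alpha> ((x \<circ> pl) p) ((x \<circ> pl) (Delta2_parent p))"
  have rest: "V - {r} - set ys = insert v (set zs)" using V v r disj by auto
  have "(\<Sum>p\<in>pverts D - {W2}. ?f p) = sum ?f spine + sum ?f ({W1} \<union> Pendant ` {1..s})"
    unfolding pverts_D by (rule sum.union_disjoint) (auto simp: spine_def)
  also have "sum ?f spine
      = (\<Sum>p\<in>spine. edge_form \<alpha> (x (ys ! spine_index p)) (x (spine_parent r ys (spine_index p))))"
    by (intro sum.cong refl) (simp add: place_spine place_parent_spine)
  also have "\<dots> = (\<Sum>k<d. edge_form \<alpha> (x (ys ! k)) (x (spine_parent r ys k)))"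
    by (rule sum.reindex_bij_betw[OF bij_spine])
  also have "sum ?f ({W1} \<union> Pendant ` {1..s})
      = (\<Sum>p\<in>{W1} \<union> Pendant ` {1..s}. edge_form \<alpha> (x (pl p)) (x r))"
    by (intro sum.cong refl) auto
  also have "\<dots> = (\<Sum>w\<in>V - {r} - set ys. edge_form \<alpha> (x w) (x r))"
    unfolding rest by (rule sum.reindex_bij_betw[OF bij_place_rest])
  finally show ?thesis
    unfolding rooted_unicyclic.alpha_form_eq[OF Delta2_rooted] by simp
qed

text \<open>
  The vertices other than \<open>W2\<close> that are not adjacent to \<open>W2\<close> are those of the spine from number 2 on. This and the
  following lemmas are the eigenvalue equations of the extremal graph, written in terms of \<open>V\<close>.
\<close>

lemma op_W2: "alpha_op \<alpha> D (x \<circ> pl) W2 = (\<Sum>w\<in>V - {r} - set (drop 2 ys). \<alpha> * x r + (1 - \<alpha>) * x w)"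
proof -
  have n: "neighbours D W2 = {p \<in> pverts D - {W2}. Delta2_parent p = W2}"
    by (subst rooted_unicyclic.neighbours_eq[OF Delta2_rooted]) auto
  have par: "Delta2_parent p = W2 \<longleftrightarrow> pl p \<notin> set (drop 2 ys)" if p: "p \<in> pverts D - {W2}" for p
  proof (cases "p \<in> spine")
    case True
    have idx: "spine_index p < d" using bij_spine True by (auto simp: bij_betw_def)
    have "pl p \<in> set (drop 2 ys) \<longleftrightarrow> (\<exists>k. k + 2 < d \<and> ys ! (k + 2) = ys ! spine_index p)"
      using ys True d by (simp add: place_spine in_set_conv_nth nth_drop add.commute less_diff_conv)
    also have "\<dots> \<longleftrightarrow> (\<exists>k. k + 2 < d \<and> k + 2 = spine_index p)"
      using ys idx by (metis nth_eq_iff_index_eq)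
    also have "\<dots> \<longleftrightarrow> 2 \<le> spine_index p" using idx by (metis add.commute le_Suc_ex le_add1)
    finally have "pl p \<in> set (drop 2 ys) \<longleftrightarrow> 2 \<le> spine_index p" .
    moreover have "Delta2_parent p = W2 \<longleftrightarrow> \<not> 2 \<le> spine_index p"
      using True by (auto simp: spine_def split: if_splits)
    ultimately show ?thesis by blast
  next
    case False
    then have "p \<in> {W1} \<union> Pendant ` {1..s}" using p pverts_D by blast
    moreover from this have "pl p \<in> insert v (set zs)" using bij_place_rest by (auto simp: bij_betw_def)
    ultimately show ?thesis using v disj by (auto dest: in_set_dropD)
  qed
  have "pl ` (pverts D - {W2}) = V - {r}" using bij_place_nonroot by (simp add: bij_betw_def)
  then have img: "pl ` {p \<in> pverts D - {W2}. pl p \<notin> set (drop 2 ys)} = {w \<in> V - {r}. w \<notin> set (drop 2 ys)}"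
    by (auto simp flip: \<open>pl ` (pverts D - {W2}) = V - {r}\<close>)
  have "pl ` {p \<in> pverts D - {W2}. Delta2_parent p = W2} = {w \<in> V - {r}. w \<notin> set (drop 2 ys)}"
    unfolding img[symmetric] by (intro arg_cong[of _ _ "image pl"] Collect_cong conj_cong refl par)
  then have "bij_betw pl {p \<in> pverts D - {W2}. Delta2_parent p = W2} {w \<in> V - {r}. w \<notin> set (drop 2 ys)}"
    by (intro bij_betw_subset[OF bij_place_nonroot]) auto
  moreover have "{w \<in> V - {r}. w \<notin> set (drop 2 ys)} = V - {r} - set (drop 2 ys)" by auto
  ultimately have b: "bij_betw pl (neighbours D W2) (V - {r} - set (drop 2 ys))" using n by simp
  show ?thesis unfolding alpha_op_def
    using sum.reindex_bij_betw[OF b, of "\<lambda>w. \<alpha> * x r + (1 - \<alpha>) * x w"] by simp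
qed

lemma op_W1: "alpha_op \<alpha> D (x \<circ> pl) W1 = 2 * \<alpha> * x v + (1 - \<alpha>) * (x r + x (ys ! 0))"
proof -
  have "neighbours D W1 = {W2, W3}"
    by (auto simp: neighbours_def parcs_Delta2_iff Delta2_parent_eq_iff)
  then show ?thesis by (simp add: alpha_op_def algebra_simps)
qed

lemma op_W3:
  assumes "3 \<le> d"
  shows "alpha_op \<alpha> D (x \<circ> pl) W3 = 3 * \<alpha> * x (ys ! 0) + (1 - \<alpha>) * (x r + x v + x (ys ! 2))"
proof -
  have "1 \<le> b" using assms by (simp add: ab)
  then have "neighbours D W3 = {W2, W1, PathB 1}"
    by (auto simp: neighbours_def parcs_Delta2_iff Delta2_parent_eq_iff)
  then show ?thesis by (simp add: alpha_op_def algebra_simps numeral_2_eq_2)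
qed

lemma op_Pendant:
  assumes "1 \<le> k" "k \<le> s"
  shows "alpha_op \<alpha> D (x \<circ> pl) (Pendant k) = \<alpha> * x (zs ! (k - 1)) + (1 - \<alpha>) * x r"
proof -
  have "neighbours D (Pendant k) = {W2}" using assms
    by (auto simp: neighbours_def parcs_Delta2_iff Delta2_parent_eq_iff)
  then show ?thesis by (simp add: alpha_op_def)
qed

lemma op_PathA:
  assumes "1 \<le> k" "k \<le> a"
  shows "alpha_op \<alpha> D (x \<circ> pl) (PathA k) =
    (if k < a then 2 else 1) * \<alpha> * x (ys ! (2 * k - 1))
    + (1 - \<alpha>) * ((if k = 1 then x r else x (ys ! (2 * (k - 1) - 1)))
       + (if k < a then x (ys ! (2 * (k + 1) - 1)) else 0))"
proof -
  have "neighbours D (PathA k) = insert (Delta2_parent (PathA k)) (if k < a then {PathA (k + 1)} else {})"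
    using assms
    by (auto simp: neighbours_def parcs_Delta2_iff Delta2_parent_eq_iff)
  then show ?thesis using assms by (auto simp: alpha_op_def algebra_simps)
qed

end

lemma placement_exists:
  assumes "finite V" "card V = n" "2 \<le> d" "d + 2 \<le> n"
    and "distinct ys" "length ys = d" "set ys \<subseteq> V - {r}" "r \<in> V" "v \<in> V - {r} - set ys"
  obtains zs where "placement V r v ys zs (n - d - 2) (d div 2) ((d - 1) div 2) d"
proof -
  let ?Z = "V - {r, v} - set ys"
  obtain zs where zs: "distinct zs" "set zs = ?Z"
    using finite_distinct_list[of ?Z] assms(1) by auto
  have "?Z = V - insert r (insert v (set ys))" by auto
  moreover have "card (insert r (insert v (set ys))) = d + 2"
    using assms by (auto simp: distinct_card card_insert_if)
  moreover have "insert r (insert v (set ys)) \<subseteq> V" using assms by auto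
  ultimately have "card ?Z = n - (d + 2)"
    using assms(1,2) by (metis card_Diff_subset finite_subset)
  then have "length zs = n - d - 2" using zs distinct_card[of zs] by simp
  then have "placement V r v ys zs (n - d - 2) (d div 2) ((d - 1) div 2) d"
    using assms zs by unfold_locales auto
  then show ?thesis by (rule that)
qed

text \<open>
  Both graphs are trees with an extra edge, so an isomorphism only has to respect the parents and the
  extra edge.
\<close>

lemma iso_Delta2I:
  assumes "rooted_unicyclic G r par lev (ys ! 0) v"
    and pl: "placement (pverts G) r v ys zs s a b d"
    and spine: "\<And>k. k < d \<Longrightarrow> par (ys ! k) = spine_parent r ys k"
    and rest: "\<And>w. w \<in> pverts G - {r} - set ys \<Longrightarrow> par w = r"
  shows "digraph_iso (with_proj G) (with_proj (Delta2 s a b))"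
proof -
  interpret rooted_unicyclic G r par lev "ys ! 0" v by fact
  interpret P: placement "pverts G" r v ys zs s a b d by fact
  interpret pair_graph G by (rule G)
  let ?D = "Delta2 s a b"
  let ?V = "pverts ?D"
  define f where "f = the_inv_into ?V P.pl"
  have inj: "inj_on P.pl ?V" and img: "P.pl ` ?V = pverts G"
    using P.bij_place by (auto simp: bij_betw_def)
  have f: "f (P.pl p) = p" if "p \<in> ?V" for p
    unfolding f_def using inj that by (simp add: the_inv_into_f_f)
  have bf: "bij_betw f (pverts G) ?V"
    unfolding f_def using P.bij_place by (rule bij_betw_the_inv_into)
  have par_place: "par (P.pl p) = P.pl (Delta2_parent p)" if "p \<in> ?V - {W2}" for p
  proof (cases "p \<in> P.spine")
    case True
    have "spine_index p < d" using P.bij_spine True by (auto simp: bij_betw_def)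
    then show ?thesis using True spine by (simp add: P.place_spine P.place_parent_spine)
  next
    case False
    then have p: "p \<in> {W1} \<union> Pendant ` {1..s}" using that P.pverts_D by blast
    then have "P.pl p \<in> insert v (set zs)" using P.bij_place_rest by (auto simp: bij_betw_def)
    then have "P.pl p \<in> pverts G - {r} - set ys" using P.V P.r P.v P.disj by auto
    then show ?thesis using rest p by auto
  qed
  have root_iff: "P.pl p = r \<longleftrightarrow> p = W2" if "p \<in> ?V" for p
    using inj_on_eq_iff[OF inj that, of W2] by simp
  have parV: "Delta2_parent p \<in> ?V" if "p \<in> ?V" for p
    using that by (cases p) auto
  have eq: "P.pl p = P.pl q \<longleftrightarrow> p = q" if "p \<in> ?V" "q \<in> ?V" for p q
    using inj_on_eq_iff[OF inj that] .
  have arc: "(P.pl p, P.pl q) \<in> parcs G \<longleftrightarrow> (p, q) \<in> parcs ?D" if p: "p \<in> ?V" and q: "q \<in> ?V" for p q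
  proof -
    have inG: "P.pl p \<in> pverts G" "P.pl q \<in> pverts G" using p q img by auto
    have 1: "P.pl p \<noteq> r \<and> P.pl q = par (P.pl p) \<longleftrightarrow> p \<noteq> W2 \<and> q = Delta2_parent p" if "p \<in> ?V" "q \<in> ?V" for p q
      using root_iff[OF that(1)] par_place[of p] eq[OF that(2) parV[OF that(1)]] that by auto
    have 2: "P.pl p = ys ! 0 \<and> P.pl q = v \<longleftrightarrow> p = W3 \<and> q = W1" if "p \<in> ?V" "q \<in> ?V" for p q
      using eq[OF that(1), of W3] eq[OF that(2), of W1] by simp
    show ?thesis
      unfolding arcs_iff parcs_Delta2_iff using 1[OF p q] 1[OF q p] 2[OF p q] 2[OF q p] inG p q by blast
  qed
  have arcs_D: "parcs ?D \<subseteq> ?V \<times> ?V"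
    unfolding parcs_Delta2_iff using parV by (auto simp: parcs_Delta2_iff)
  have farc: "(f s, f t) \<in> parcs ?D" if "(s, t) \<in> parcs G" for s t
  proof -
    have st: "s \<in> pverts G" "t \<in> pverts G" using that in_arcsD1 in_arcsD2 by auto
    then obtain p q where "p \<in> ?V" "s = P.pl p" "q \<in> ?V" "t = P.pl q"
      using img by (metis (no_types, lifting) imageE)
    then show ?thesis using that arc f by simp
  qed
  have img_arcs: "map_prod f f ` parcs G = parcs ?D"
  proof
    show "map_prod f f ` parcs G \<subseteq> parcs ?D" using farc by auto
    show "parcs ?D \<subseteq> map_prod f f ` parcs G"
    proof
      fix e assume "e \<in> parcs ?D"
      then obtain p q where e: "e = (p, q)" "(p, q) \<in> parcs ?D" "p \<in> ?V" "q \<in> ?V"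
        using arcs_D by (cases e) auto
      then have "(P.pl p, P.pl q) \<in> parcs G" using arc by simp
      then show "e \<in> map_prod f f ` parcs G" using e f by (intro image_eqI[of _ _ "(P.pl p, P.pl q)"]) auto
    qed
  qed
  define h where "h = \<lparr>iso_verts = f, iso_arcs = map_prod f f, iso_head = snd, iso_tail = fst\<rparr>"
  have "inj_on f (pverts G)" using bf by (simp add: bij_betw_def)
  then have "inj_on (map_prod f f) (parcs G)"
    using in_arcsD1 in_arcsD2 by (auto simp: inj_on_def)
  then have "digraph_isomorphism h"
    unfolding digraph_isomorphism_def using \<open>inj_on f (pverts G)\<close> wf_digraph_axioms
    by (auto simp: h_def)
  moreover have "with_proj ?D = app_iso h (with_proj G)"
    using img_arcs bf by (simp add: app_iso_def h_def with_proj_def bij_betw_def)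
  ultimately show ?thesis unfolding digraph_iso_def by blast
qed

section \<open>Two chains in a breadth-first search tree\<close>

context rooted_unicyclic
begin

definition anc :: "'a \<Rightarrow> nat \<Rightarrow> 'a" where
  "anc w k = (par ^^ k) w"

definition chain :: "'a \<Rightarrow> nat \<Rightarrow> 'a set" where
  "chain w i = anc w ` {..<i}"

lemma anc_0 [simp]: "anc w 0 = w"
  and anc_Suc [simp]: "anc w (Suc k) = par (anc w k)"
  by (simp_all add: anc_def)

lemma lev_eq_0: "w \<in> pverts G \<Longrightarrow> lev w = 0 \<Longrightarrow> w = r"
  using lev by force

lemma anc_lev:
  assumes "w \<in> pverts G" "k \<le> lev w"
  shows "anc w k \<in> pverts G \<and> lev (anc w k) = lev w - k"
  using assms(2)
proof (induction k)
  case 0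
  then show ?case using assms(1) by simp
next
  case (Suc k)
  then have IH: "anc w k \<in> pverts G" "lev (anc w k) = lev w - k" by auto
  have "anc w k \<noteq> r"
  proof
    assume "anc w k = r"
    then show False using IH(2) root(2) Suc.prems by simp
  qed
  then show ?case using par[OF IH(1)] lev[OF IH(1)] IH(2) by simp
qed

lemma anc_root: "w \<in> pverts G \<Longrightarrow> anc w (lev w) = r"
  using anc_lev[of w "lev w"] lev_eq_0 by simp

lemma anc_not_root:
  assumes "w \<in> pverts G" "k < lev w"
  shows "anc w k \<noteq> r"
proof
  assume "anc w k = r"
  then show False using anc_lev[of w k] assms root(2) by simp
qed

lemma anc_walk:
  assumes "w \<in> pverts G" "k \<le> lev w"
  shows "(w, anc w k) \<in> parcs G ^^ k"
  using assms(2)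
proof (induction k)
  case 0
  then show ?case by simp
next
  case (Suc k)
  then have "(anc w k, anc w (Suc k)) \<in> parcs G"
    using anc_lev[of w k] anc_not_root[of w k] assms(1) by (auto simp: arcs_iff)
  then show ?case using Suc by auto
qed

context
  fixes w i
  assumes w: "w \<in> pverts G" and i: "i \<le> lev w"
begin

lemma chain_subset: "chain w i \<subseteq> pverts G - {r}"
proof
  fix s assume "s \<in> chain w i"
  then obtain k where "k < i" "s = anc w k" by (auto simp: chain_def)
  then show "s \<in> pverts G - {r}"
    using anc_lev[OF w, of k] anc_not_root[OF w, of k] i by simp
qed

lemma inj_on_lev_chain: "inj_on lev (chain w i)"
proof (rule inj_onI)
  fix s t assume "s \<in> chain w i" "t \<in> chain w i" "lev s = lev t"
  then obtain k l where "k < i" "s = anc w k" "l < i" "t = anc w l" "lev s = lev t"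
    by (auto simp: chain_def)
  moreover from this have "k = l"
    using anc_lev[OF w, of k] anc_lev[OF w, of l] i by simp
  ultimately show "s = t" by simp
qed

lemma card_chain: "card (chain w i) = i"
proof -
  have "inj_on (anc w) {..<i}"
  proof (rule inj_onI)
    fix k l assume "k \<in> {..<i}" "l \<in> {..<i}" "anc w k = anc w l"
    moreover from this have "lev w - k = lev w - l" using anc_lev[OF w] i by (metis lessThan_iff less_imp_le order.trans)
    ultimately show "k = l" using i by simp
  qed
  then show ?thesis by (simp add: chain_def card_image)
qed

lemma inj_on_par_chain: "inj_on par (chain w i)"
proof (rule inj_onI)
  fix s t assume st: "s \<in> chain w i" "t \<in> chain w i" "par s = par t"
  then have "s \<in> pverts G" "s \<noteq> r" "t \<in> pverts G" "t \<noteq> r" using chain_subset by auto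
  then have "lev s = lev t" using lev[of s] lev[of t] st(3) by simp
  then show "s = t" using inj_onD[OF inj_on_lev_chain] st by blast
qed

lemma chain_top: "s \<in> chain w i \<Longrightarrow> par s \<notin> chain w i \<Longrightarrow> s = anc w (i - 1)"
proof -
  assume "s \<in> chain w i" "par s \<notin> chain w i"
  then obtain k where k: "k < i" "s = anc w k" by (auto simp: chain_def)
  have "\<not> Suc k < i"
  proof
    assume "Suc k < i"
    then have "anc w (Suc k) \<in> chain w i" unfolding chain_def by blast
    then show False using \<open>par s \<notin> chain w i\<close> k by simp
  qed
  then have "k = i - 1" using k by simp
  then show ?thesis using k by simp
qed

end

end

locale bfs_unicyclic = rooted_unicyclic +
  assumes lev_arc: "(s, t) \<in> parcs G \<Longrightarrow> lev t \<le> Suc (lev s)"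
begin

lemma extra_not_in_chain:
  assumes w: "w \<in> pverts G" and uv: "u \<in> chain w (lev w)" "v \<in> chain w (lev w)"
  shows False
proof -
  obtain k l where kl: "k < lev w" "u = anc w k" "l < lev w" "v = anc w l"
    using uv by (auto simp: chain_def)
  have "(u, v) \<in> parcs G" "(v, u) \<in> parcs G" by (auto simp: arcs_iff)
  then have "lev v \<le> Suc (lev u)" "lev u \<le> Suc (lev v)" using lev_arc by auto
  then have "l = k \<or> l = Suc k \<or> k = Suc l"
    using anc_lev[OF w] kl by fastforce
  then show False using extra kl by auto
qed

text \<open>
  Let \<open>A\<close> be the tree path from \<open>p\<close> up to the root, without the root, and climb from \<open>q\<close> until meeting
  the root, \<open>A\<close>, or an end of the extra edge whose other end is in \<open>A\<close>; this takes \<open>J\<close> steps. From the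
  vertex reached one gets to \<open>p\<close> in at most \<open>lev p\<close> steps: in the last case one step is spent on the
  extra edge, but the vertex of \<open>A\<close> reached by it is at most \<open>lev p - 1\<close> steps away from \<open>p\<close>. Hence
  \<open>d \<le> lev p + J\<close>, so there is enough room for chains with \<open>d\<close> vertices in total.
\<close>

lemma two_chains:
  assumes p: "p \<in> pverts G" and q: "q \<in> pverts G"
    and dist: "\<And>k. (p, q) \<in> parcs G ^^ k \<Longrightarrow> d \<le> k"
  obtains i j where "i + j = d" "i \<le> lev p" "j \<le> lev q" "chain p i \<inter> chain q j = {}"
    "\<not> (u \<in> chain p i \<union> chain q j \<and> v \<in> chain p i \<union> chain q j)"
proof -
  define A where "A = chain p (lev p)"
  \<comment> \<open>climbing on past an end of the extra edge could put both of its ends on the chains\<close>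
  define X where "X = {w. (w = u \<and> v \<in> A) \<or> (w = v \<and> u \<in> A)}"
  define J where "J = (LEAST k. anc q k \<in> A \<union> {r} \<union> X)"
  have ex: "anc q (lev q) \<in> A \<union> {r} \<union> X" using anc_root[OF q] by simp
  have Jw: "anc q J \<in> A \<union> {r} \<union> X" unfolding J_def using ex by (rule LeastI)
  have J_le: "J \<le> lev q" unfolding J_def using ex by (rule Least_le)
  have J_min: "anc q k \<notin> A \<union> {r} \<union> X" if "k < J" for k
    using not_less_Least that unfolding J_def by blast
  have toA: "\<exists>k<lev p. (p, w) \<in> parcs G ^^ k" if "w \<in> A" for w
    using that anc_walk[OF p] by (auto simp: A_def chain_def)
  have ex_walk: "\<exists>k\<le>lev p. (p, anc q J) \<in> parcs G ^^ k"
  proof -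
    consider "anc q J \<in> A" | "anc q J = r" | "anc q J \<in> X" using Jw by blast
    then show ?thesis
    proof cases
      case 1
      then show ?thesis using toA by (meson less_imp_le)
    next
      case 2
      then show ?thesis using walk_to_root[OF p] by auto
    next
      case 3
      then obtain t where t: "t \<in> A" "(t, anc q J) \<in> parcs G" by (auto simp: X_def arcs_iff)
      obtain k where "k < lev p" "(p, t) \<in> parcs G ^^ k" using toA[OF t(1)] by blast
      then show ?thesis using t(2) by (intro exI[of _ "Suc k"]) auto
    qed
  qed
  then obtain k where k: "k \<le> lev p" "(p, anc q J) \<in> parcs G ^^ k" by blast
  have "(anc q J, q) \<in> parcs G ^^ J" by (rule relpow_parcs_sym[OF G anc_walk[OF q J_le]])
  then have "(p, q) \<in> parcs G ^^ (k + J)" using k(2) by (auto simp: relpow_add)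
  then have d: "d \<le> lev p + J" using dist k(1) by fastforce
  define i where "i = min d (lev p)"
  define j where "j = d - i"
  have ij: "i + j = d" "i \<le> lev p" "j \<le> J" using d by (auto simp: i_def j_def)
  have sub: "chain p i \<subseteq> A" using ij by (auto simp: A_def chain_def)
  have dis: "w \<notin> A \<union> {r} \<union> X" if w: "w \<in> chain q j" for w
  proof -
    obtain k where "k < j" "w = anc q k" using w by (auto simp: chain_def)
    then show ?thesis using J_min[of k] ij by simp
  qed
  have subq: "chain q j \<subseteq> chain q (lev q)" using ij J_le by (auto simp: chain_def)
  have "\<not> (u \<in> chain p i \<union> chain q j \<and> v \<in> chain p i \<union> chain q j)"
  proof
    assume uv: "u \<in> chain p i \<union> chain q j \<and> v \<in> chain p i \<union> chain q j"
    then consider "u \<in> A" "v \<in> A" | "u \<in> chain q j" "v \<in> chain q j"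
      | "u \<in> A" "v \<in> chain q j" | "v \<in> A" "u \<in> chain q j"
      using sub by blast
    then show False
    proof cases
      case 1
      then show ?thesis using extra_not_in_chain[OF p] by (simp add: A_def)
    next
      case 2
      then show ?thesis using extra_not_in_chain[OF q] subq by blast
    next
      case 3
      then show ?thesis using dis[of v] by (simp add: X_def)
    next
      case 4
      then show ?thesis using dis[of u] by (simp add: X_def)
    qed
  qed
  moreover have "chain p i \<inter> chain q j = {}" using sub dis by blast
  ultimately show ?thesis using that ij J_le by (metis order.trans)
qed

end

section \<open>Comparing the quadratic forms\<close>

text \<open>
  The two chains have \<open>i\<close> and \<open>j\<close> vertices and start at \<open>p\<close> and \<open>q\<close>; one of them may be empty. The list
  \<open>cs\<close> sorts their vertices by decreasing value.
\<close>

locale two_chain_unicyclic = bfs_unicyclic +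
  fixes p q :: 'a and i j d :: nat and x :: "'a \<Rightarrow> real" and \<alpha> :: real and cs :: "'a list"
  assumes pq: "p \<in> pverts G" "q \<in> pverts G"
    and ij: "i + j = d" "i \<le> lev p" "j \<le> lev q" "2 \<le> d"
    and disjoint_chains: "chain p i \<inter> chain q j = {}"
    and v_not_in_chains: "v \<notin> chain p i \<union> chain q j"
    and \<alpha>: "0 \<le> \<alpha>" "\<alpha> < 1"
    and x_pos: "w \<in> pverts G \<Longrightarrow> 0 < x w"
    and x_max: "w \<in> pverts G \<Longrightarrow> x w \<le> x r"
    and cs: "distinct cs" "set cs = chain p i \<union> chain q j" "sorted_wrt (\<lambda>s t. x t \<le> x s) cs"
begin

abbreviation "C \<equiv> set cs"

lemma C_subset: "C \<subseteq> pverts G - {r}"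
  using chain_subset[OF pq(1) ij(2)] chain_subset[OF pq(2) ij(3)] cs by blast

lemma length_cs: "length cs = d"
proof -
  have "card C = card (chain p i) + card (chain q j)"
    unfolding cs(2) using disjoint_chains by (intro card_Un_disjoint) (auto simp: chain_def)
  then show ?thesis
    using card_chain[OF pq(1) ij(2)] card_chain[OF pq(2) ij(3)] ij(1) distinct_card[OF cs(1)] by simp
qed

lemma cs_in: "k < d \<Longrightarrow> cs ! k \<in> C"
  using length_cs by simp

lemma x_cs_antimono: "k \<le> l \<Longrightarrow> l < d \<Longrightarrow> x (cs ! l) \<le> x (cs ! k)"
  using sorted_wrt_nth_less[OF cs(3)] length_cs by (cases "k = l") auto

text \<open>
  The sorted values, continued by \<open>0\<close> so that the sequence is antitone on all natural numbers.
\<close>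

definition y :: "nat \<Rightarrow> real" where
  "y k = (if k < d then x (cs ! k) else 0)"

lemma y_antimono: "antimono y"
proof (rule antimonoI)
  fix k l :: nat assume "k \<le> l"
  then show "y l \<le> y k"
    using x_cs_antimono[of k l] x_pos C_subset cs_in[of k] by (auto simp: y_def less_imp_le subset_iff)
qed

lemma y_nonneg: "0 \<le> y k"
  using x_pos C_subset cs_in[of k] by (auto simp: y_def less_imp_le subset_iff)

text \<open>
  Each chain vertex can serve as the parent of at most one vertex of its own chain, and the root of
  at most two, namely the tops of the chains. A vertex whose parent is outside its chain is charged to
  the root, which has the largest value. So the values of the parents are taken injectively from the
  sequence \<open>x r, x r, y 0, y 1, \<dots>\<close>, and the rearrangement inequality applies.
\<close>

lemma chain_sum_le:
  "(\<Sum>w\<in>C. edge_form \<alpha> (x w) (x (par w)))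
    \<le> (\<Sum>k<d. edge_form \<alpha> (x (cs ! k)) (x (spine_parent r cs k)))"
proof -
  define z where "z k = (if k < 2 then x r else y (k - 2))" for k
  define pos where "pos = the_inv_into {..<d} ((!) cs)"
  define same where "same w \<longleftrightarrow> (w \<in> chain p i \<and> par w \<in> chain p i) \<or> (w \<in> chain q j \<and> par w \<in> chain q j)" for w
  \<comment> \<open>the position of the parent in \<open>z\<close>; the two tops take the two copies of the root\<close>
  define f where "f k = (if same (cs ! k) then pos (par (cs ! k)) + 2
      else if cs ! k \<in> chain p i then 0 else 1)" for k
  have inj: "inj_on ((!) cs) {..<d}" using cs(1) length_cs by (auto simp: inj_on_def nth_eq_iff_index_eq)
  have img: "(!) cs ` {..<d} = C" using length_cs by (auto simp: in_set_conv_nth)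
  have bij: "bij_betw ((!) cs) {..<d} C" using inj img by (simp add: bij_betw_def)
  have pos: "pos w < d" "cs ! pos w = w" if "w \<in> C" for w
    using the_inv_into_into[OF inj, of w] f_the_inv_into_f[OF inj, of w] that img
    by (auto simp: pos_def)
  have same_C: "par w \<in> C" if "same w" for w using that cs(2) by (auto simp: same_def)
  have xr: "0 < x r" using x_pos root by simp
  have y_le: "y k \<le> x r" for k
    using x_max C_subset cs_in[of k] xr by (auto simp: y_def less_imp_le subset_iff)
  have z: "antimono z" "0 \<le> z k" for k
    using y_antimono y_le y_nonneg xr by (auto simp: z_def antimono_def less_imp_le)
  have "inj_on f {..<d}"
  proof (rule inj_onI)
    fix k l assume kl: "k \<in> {..<d}" "l \<in> {..<d}" "f k = f l"
    let ?s = "cs ! k" and ?t = "cs ! l"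
    have in_C: "?s \<in> chain p i \<union> chain q j" "?t \<in> chain p i \<union> chain q j"
      using kl cs_in cs(2) by auto
    have "?s = ?t"
    proof (cases "same ?s")
      case True
      then have t: "same ?t" using kl(3) by (auto simp: f_def split: if_splits)
      then have eq: "par ?s = par ?t"
        using kl(3) True pos(2)[OF same_C] by (metis add_right_cancel f_def)
      then show ?thesis
        using True t disjoint_chains inj_onD[OF inj_on_par_chain[OF pq(1) ij(2)]]
          inj_onD[OF inj_on_par_chain[OF pq(2) ij(3)]]
        unfolding same_def by (metis disjoint_iff)
    next
      case False
      then have t: "\<not> same ?t" and e: "?s \<in> chain p i \<longleftrightarrow> ?t \<in> chain p i"
        using kl(3) by (auto simp: f_def split: if_splits)
      show ?thesis
        using False t e in_C chain_top[OF pq(1) ij(2)] chain_top[OF pq(2) ij(3)]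
        unfolding same_def by (metis UnE)
    qed
    then show "k = l" using inj_onD[OF inj] kl by blast
  qed
  from edge_form_rearrangement[OF \<alpha> y_antimono y_nonneg z this]
  have "(\<Sum>k<d. edge_form \<alpha> (y k) (z (f k))) \<le> (\<Sum>k<d. edge_form \<alpha> (y k) (z k))" .
  also have "\<dots> = (\<Sum>k<d. edge_form \<alpha> (x (cs ! k)) (x (spine_parent r cs k)))"
    by (intro sum.cong refl) (auto simp: y_def z_def spine_parent_def)
  finally have le: "(\<Sum>k<d. edge_form \<alpha> (y k) (z (f k)))
      \<le> (\<Sum>k<d. edge_form \<alpha> (x (cs ! k)) (x (spine_parent r cs k)))" .
  have "(\<Sum>w\<in>C. edge_form \<alpha> (x w) (x (par w))) = (\<Sum>k<d. edge_form \<alpha> (x (cs ! k)) (x (par (cs ! k))))"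
    by (rule sum.reindex_bij_betw[OF bij, symmetric])
  also have "\<dots> \<le> (\<Sum>k<d. edge_form \<alpha> (y k) (z (f k)))"
  proof (rule sum_mono)
    fix k assume "k \<in> {..<d}"
    then have k: "k < d" "cs ! k \<in> pverts G" "par (cs ! k) \<in> pverts G"
      using cs_in C_subset par by auto
    have "x (par (cs ! k)) \<le> z (f k)"
    proof (cases "same (cs ! k)")
      case True
      then show ?thesis using pos[OF same_C[OF True]] by (simp add: f_def z_def y_def)
    next
      case False
      then show ?thesis using x_max[OF k(3)] by (simp add: f_def z_def)
    qed
    then show "edge_form \<alpha> (x (cs ! k)) (x (par (cs ! k))) \<le> edge_form \<alpha> (y k) (z (f k))"
      using k x_pos[OF k(2)] x_pos[OF k(3)] by (intro edge_form_mono \<alpha>) (auto simp: y_def)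
  qed
  finally show ?thesis using le by linarith
qed

text \<open>
  The quadratic form of \<open>x\<close> on the extremal graph when \<open>ys\<close> is placed on its spine and \<open>v\<close> at \<open>W1\<close>; see
  \<open>alpha_form_place\<close>.
\<close>

definition caterpillar_form :: "'a list \<Rightarrow> real" where
  "caterpillar_form ys = (\<Sum>k<d. edge_form \<alpha> (x (ys ! k)) (x (spine_parent r ys k)))
     + (\<Sum>w\<in>pverts G - {r} - set ys. edge_form \<alpha> (x w) (x r)) + edge_form \<alpha> (x (ys ! 0)) (x v)"

lemma alpha_form_le_star:
  "alpha_form \<alpha> G x \<le> (\<Sum>k<d. edge_form \<alpha> (x (cs ! k)) (x (spine_parent r cs k)))
     + (\<Sum>w\<in>pverts G - {r} - C. edge_form \<alpha> (x w) (x r)) + edge_form \<alpha> (x u) (x v)"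
proof -
  have "(\<Sum>w\<in>pverts G - {r}. edge_form \<alpha> (x w) (x (par w)))
      = (\<Sum>w\<in>pverts G - {r} - C. edge_form \<alpha> (x w) (x (par w))) + (\<Sum>w\<in>C. edge_form \<alpha> (x w) (x (par w)))"
    using C_subset finite_verts by (intro sum.subset_diff) auto
  moreover have "(\<Sum>w\<in>pverts G - {r} - C. edge_form \<alpha> (x w) (x (par w)))
      \<le> (\<Sum>w\<in>pverts G - {r} - C. edge_form \<alpha> (x w) (x r))"
    using x_pos x_max par by (intro sum_mono edge_form_mono \<alpha>) (auto simp: less_imp_le)
  ultimately show ?thesis using chain_sum_le unfolding alpha_form_eq by linarith
qed

lemma u_in: "u \<in> pverts G" "v \<in> pverts G" using extra by auto

lemma alpha_form_le_caterpillar: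
  assumes "x u \<le> x (cs ! 0)"
  shows "alpha_form \<alpha> G x \<le> caterpillar_form cs"
proof -
  have "edge_form \<alpha> (x u) (x v) \<le> edge_form \<alpha> (x (cs ! 0)) (x v)"
    using assms x_pos u_in by (intro edge_form_mono \<alpha>) (auto simp: less_imp_le)
  then show ?thesis using alpha_form_le_star by (simp add: caterpillar_form_def)
qed

text \<open>
  In the rearranged tree \<open>u\<close> and \<open>cs ! 0\<close> are both children of the root, so exchanging them only affects the
  extra edge and the edge from \<open>W3\<close> to its child. Both gain from the larger value.
\<close>

lemma alpha_form_le_caterpillar_exchange:
  assumes u: "u \<notin> C" and gt: "x (cs ! 0) < x u"
  shows "alpha_form \<alpha> G x \<le> caterpillar_form (cs[0 := u])"
proof -
  let ?ys = "cs[0 := u]"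
  let ?e = "\<lambda>w. edge_form \<alpha> (x w) (x r)"
  have d: "0 < d" using ij by simp
  have c0: "cs ! 0 \<in> C" "cs ! 0 \<in> pverts G" using cs_in[OF d] C_subset by auto
  let ?R = "pverts G - {r} - C - {u}"
  have "set ?ys = insert u (C - {cs ! 0})"
    using set_update_distinct[OF cs(1)] d length_cs by simp
  then have R: "pverts G - {r} - C = insert u ?R" "pverts G - {r} - set ?ys = insert (cs ! 0) ?R"
    using u u_in extra c0 C_subset by auto
  have s1: "sum ?e (pverts G - {r} - C) = ?e u + sum ?e ?R"
    using finite_verts by (subst R(1), subst sum.insert) auto
  have s2: "sum ?e (pverts G - {r} - set ?ys) = ?e (cs ! 0) + sum ?e ?R"
    using finite_verts c0 by (subst R(2), subst sum.insert) auto
  have split: "{..<d} = insert 0 {1..<d}" using d by auto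
  have "(\<Sum>k\<in>{1..<d}. edge_form \<alpha> (x (cs ! k)) (x (spine_parent r cs k)))
      \<le> (\<Sum>k\<in>{1..<d}. edge_form \<alpha> (x (?ys ! k)) (x (spine_parent r ?ys k)))"
  proof (rule sum_mono)
    fix k assume k: "k \<in> {1..<d}"
    have in_V: "cs ! l \<in> pverts G" if "l < d" for l using cs_in[OF that] C_subset by blast
    have "x (spine_parent r cs k) \<le> x (spine_parent r ?ys k)"
      using k gt length_cs by (cases "k = 2") (auto simp: spine_parent_def nth_list_update)
    moreover have "0 \<le> x (spine_parent r cs k)"
      using k in_V[of "k - 2"] root x_pos by (auto simp: spine_parent_def less_imp_le)
    ultimately show "edge_form \<alpha> (x (cs ! k)) (x (spine_parent r cs k))
        \<le> edge_form \<alpha> (x (?ys ! k)) (x (spine_parent r ?ys k))"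
      using k x_pos[OF in_V[of k]] by (intro edge_form_mono \<alpha>) auto
  qed
  then have "(\<Sum>k<d. edge_form \<alpha> (x (cs ! k)) (x (spine_parent r cs k))) + ?e u
      \<le> (\<Sum>k<d. edge_form \<alpha> (x (?ys ! k)) (x (spine_parent r ?ys k))) + ?e (cs ! 0)"
    unfolding split using d length_cs by (simp add: spine_parent_def)
  then show ?thesis
    using alpha_form_le_star s1 s2 d length_cs by (simp add: caterpillar_form_def)
qed

end

section \<open>The case of equality\<close>

text \<open>
  Along a pendant path the eigenvalue equations are a three-term recurrence, so two paths that agree in
  their first two values agree as long as both last. At the end of the shorter one, the equation lacks
  the positive terms that come from the next vertex of the longer one.
\<close>

lemma pendant_path_length_le:
  fixes X Y :: "nat \<Rightarrow> real"
  assumes \<alpha>: "0 \<le> \<alpha>" "\<alpha> < 1" and j: "1 \<le> j" and start: "X 0 = Y 0" "X 1 = Y 1"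
    and X: "\<And>k. 1 \<le> k \<Longrightarrow> k \<le> j \<Longrightarrow> \<rho> * X k = (if k < j then 2 else 1) * \<alpha> * X k
      + (1 - \<alpha>) * (X (k - 1) + (if k < j then X (k + 1) else 0))"
    and Y: "\<And>k. 1 \<le> k \<Longrightarrow> k \<le> a \<Longrightarrow> \<rho> * Y k = (if k < a then 2 else 1) * \<alpha> * Y k
      + (1 - \<alpha>) * (Y (k - 1) + (if k < a then Y (k + 1) else 0))"
    and pos: "\<And>k. k \<le> a \<Longrightarrow> 0 < Y k"
  shows "a \<le> j"
proof (rule ccontr)
  assume "\<not> a \<le> j"
  then have ja: "j < a" by simp
  have "k \<le> j \<Longrightarrow> X k = Y k \<and> X (k - 1) = Y (k - 1)" for k
  proof (induction k)
    case 0
    then show ?case using start by simp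
  next
    case (Suc k)
    show ?case
    proof (cases "k = 0")
      case True
      then show ?thesis using start by simp
    next
      case False
      then have IH: "X k = Y k" "X (k - 1) = Y (k - 1)" using Suc by auto
      have "\<rho> * X k = 2 * \<alpha> * X k + (1 - \<alpha>) * (X (k - 1) + X (Suc k))"
        using X[of k] Suc.prems False by simp
      moreover have "\<rho> * Y k = 2 * \<alpha> * Y k + (1 - \<alpha>) * (Y (k - 1) + Y (Suc k))"
        using Y[of k] Suc.prems False ja by simp
      ultimately have "(1 - \<alpha>) * X (Suc k) = (1 - \<alpha>) * Y (Suc k)"
        using IH by (simp add: algebra_simps)
      then show ?thesis using \<alpha> IH by simp
    qed
  qed
  then have "X j = Y j" "X (j - 1) = Y (j - 1)" by auto
  moreover have "\<rho> * X j = \<alpha> * X j + (1 - \<alpha>) * X (j - 1)" using X[of j] j by simp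
  moreover have "\<rho> * Y j = 2 * \<alpha> * Y j + (1 - \<alpha>) * (Y (j - 1) + Y (j + 1))"
    using Y[of j] j ja by simp
  ultimately have "\<alpha> * Y j + (1 - \<alpha>) * Y (j + 1) = 0" by (simp add: algebra_simps)
  moreover have "0 < (1 - \<alpha>) * Y (j + 1)" "0 \<le> \<alpha> * Y j"
    using pos[of "j + 1"] pos[of j] ja \<alpha> by auto
  ultimately show False by linarith
qed

text \<open>
  The Rayleigh quotient of the all-ones vector is the average degree, which is 2. If this were the
  spectral radius, the all-ones vector would be an eigenvector and \<open>G\<close> would be regular of degree 2.
\<close>

lemma (in rooted_unicyclic) alpha_spectral_radius_gt_2:
  assumes \<alpha>: "0 \<le> \<alpha>" "\<alpha> < 1" and deg: "3 \<le> card (neighbours G r)"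
  shows "2 < alpha_spectral_radius \<alpha> G"
proof -
  let ?\<rho> = "alpha_spectral_radius \<alpha> G" and ?n = "real (card (pverts G))"
  have ne: "pverts G \<noteq> {}" using root by auto
  have n: "0 < card (pverts G)" using finite_verts ne by (simp add: card_gt_0_iff)
  have e: "edge_form \<alpha> 1 1 = 2" by (simp add: edge_form_def)
  have "alpha_form \<alpha> G (\<lambda>_. 1) = 2 * real (card (pverts G - {r})) + 2"
    unfolding alpha_form_eq e by simp
  also have "\<dots> = 2 * ?n" using n root finite_verts by (simp add: card_Diff_singleton of_nat_diff)
  finally have form: "alpha_form \<alpha> G (\<lambda>_. 1) = 2 * ?n" .
  have norm: "sqnorm G (\<lambda>_. 1) = ?n" by (simp add: sqnorm_def)
  have "2 * ?n \<le> ?\<rho> * ?n" using alpha_form_le[OF G ne \<alpha>, of "\<lambda>_. 1"] form norm by simp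
  then have "2 \<le> ?\<rho>" using n by simp
  moreover have "?\<rho> \<noteq> 2"
  proof
    assume 2: "?\<rho> = 2"
    then have "alpha_op \<alpha> G (\<lambda>_. 1) r = 2"
      using alpha_form_eq_imp_eigenvector[OF G ne \<alpha>, of "\<lambda>_. 1" r] form norm root by simp
    then have "real (card (neighbours G r)) = 2" by (simp add: alpha_op_def)
    then show False using deg by simp
  qed
  ultimately show ?thesis by simp
qed

text \<open>
  The situation in which the spectral radii of \<open>G\<close> and of the extremal graph agree: the vector \<open>x\<close>
  satisfies the eigenvalue equations of both.
\<close>

locale tight_unicyclic = two_chain_unicyclic +
  P: placement "pverts G" r v ys zs s a b d for ys zs s a b +
  assumes ys_cases: "(ys = cs \<and> x u \<le> x (cs ! 0)) \<or> (ys = cs[0 := u] \<and> u \<notin> C)"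
    and eig: "w \<in> pverts G \<Longrightarrow> alpha_op \<alpha> G x w = alpha_spectral_radius \<alpha> G * x w"
    and eig_D: "t \<in> pverts P.D \<Longrightarrow>
      alpha_op \<alpha> P.D (x \<circ> P.pl) t = alpha_spectral_radius \<alpha> G * x (P.pl t)"
begin

abbreviation "\<rho> \<equiv> alpha_spectral_radius \<alpha> G"

definition R :: "'a set" where "R = pverts G - {r} - C"

lemma finite_R: "finite R" using finite_verts by (simp add: R_def)

lemma v_in_R: "v \<in> R" using extra v_not_in_chains cs by (simp add: R_def)

lemma cs_inj: "k < d \<Longrightarrow> l < d \<Longrightarrow> cs ! k = cs ! l \<longleftrightarrow> k = l"
  using cs(1) length_cs by (simp add: nth_eq_iff_index_eq)

lemma sum_subset_C_le:
  assumes T: "T \<subseteq> C" and h: "mono h" "0 \<le> h 0"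
  shows "(\<Sum>w\<in>T. h (x w)) \<le> (\<Sum>k<card T. (h (x (cs ! k)) :: real))"
proof -
  define z where "z k = (if k < d then h (x (cs ! k)) else 0)" for k
  have hx: "0 \<le> h (x (cs ! k))" if "k < d" for k
  proof -
    have "0 \<le> x (cs ! k)" using x_pos C_subset cs_in[OF that] by (auto simp: less_imp_le)
    then show ?thesis using h monoD[OF h(1), of 0 "x (cs ! k)"] by simp
  qed
  have z: "antimono z"
  proof (rule antimonoI)
    fix k l :: nat assume "k \<le> l"
    then show "z l \<le> z k"
      using hx x_cs_antimono[of k l] h(1) by (auto simp: z_def mono_def)
  qed
  define S where "S = {k. k < d \<and> cs ! k \<in> T}"
  have bij: "bij_betw ((!) cs) S T"
    unfolding bij_betw_def
  proof
    show "inj_on ((!) cs) S" using cs_inj by (auto simp: S_def inj_on_def)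
    show "(!) cs ` S = T"
      using T length_cs by (auto simp: S_def in_set_conv_nth subset_iff image_iff)
  qed
  have "(\<Sum>w\<in>T. h (x w)) = (\<Sum>k\<in>S. h (x (cs ! k)))"
    by (rule sum.reindex_bij_betw[OF bij, symmetric])
  also have "\<dots> = sum z S" by (intro sum.cong) (auto simp: S_def z_def)
  also have "\<dots> \<le> (\<Sum>k<card S. z k)"
    by (rule sum_le_sum_initial[OF z]) (simp add: S_def)
  also have "card S = card T" by (rule bij_betw_same_card[OF bij])
  also have "(\<Sum>k<card T. z k) = (\<Sum>k<card T. h (x (cs ! k)))"
  proof (intro sum.cong refl)
    fix k assume "k \<in> {..<card T}"
    moreover have "card T \<le> d"
      using card_mono[OF _ T] distinct_card[OF cs(1)] length_cs by simp
    ultimately show "z k = h (x (cs ! k))" by (simp add: z_def)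
  qed
  finally show ?thesis .
qed

lemma neighbours_root: "neighbours G r = {t \<in> pverts G - {r}. par t = r}"
  using neighbours_eq[OF root(1)] extra by auto

text \<open>
  The neighbours of the root in the extremal graph are the set \<open>R\<close> of vertices off the chains and two
  vertices that have the largest values on the chains. In \<open>G\<close> the root is adjacent to some vertices of
  \<open>R\<close> and to at most two chain vertices, the tops. The eigenvalue equations at the root make the sums of
  the values over both neighbourhoods match, and all values are positive, so nothing can be missing.
\<close>

lemma root_row:
  shows rest_par: "w \<in> R \<Longrightarrow> par w = r"
    and tops: "0 < i" "0 < j" "par (anc p (i - 1)) = r" "par (anc q (j - 1)) = r"
    and top_values: "x (anc p (i - 1)) + x (anc q (j - 1)) = x (cs ! 0) + x (cs ! 1)"
    and deg_root: "3 \<le> card (neighbours G r)"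
proof -
  define g where "g w = \<alpha> * x r + (1 - \<alpha>) * x w" for w
  have xr: "0 < x r" using x_pos root by simp
  have g_pos: "0 < g w" if "w \<in> pverts G" for w
    using x_pos[OF that] xr \<alpha> by (auto simp: g_def intro!: add_nonneg_pos)
  define T where "T = neighbours G r \<inter> C"
  have c01: "cs ! 0 \<in> C" "cs ! 1 \<in> C" using cs_in ij(4) by auto
  have c_ne: "cs ! 0 \<noteq> cs ! 1" using cs_inj[of 0 1] ij(4) by simp
  have drop: "drop 2 ys = drop 2 cs" using ys_cases by auto
  have setcs: "C = {cs ! 0, cs ! 1} \<union> set (drop 2 cs)" "{cs ! 0, cs ! 1} \<inter> set (drop 2 cs) = {}"
  proof -
    have "cs = cs ! 0 # cs ! 1 # drop 2 cs"
      using length_cs ij(4) by (cases cs; cases "tl cs") auto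
    then show "C = {cs ! 0, cs ! 1} \<union> set (drop 2 cs)" "{cs ! 0, cs ! 1} \<inter> set (drop 2 cs) = {}"
      using cs(1) by (metis list.simps(15) insert_is_Un sup_assoc, metis disjoint_insert(1) distinct.simps(2) inf_bot_left insert_is_Un list.set_intros(2) Int_Un_distrib2 Int_insert_left)
  qed
  have N': "pverts G - {r} - set (drop 2 ys) = R \<union> {cs ! 0, cs ! 1}"
    unfolding drop R_def using setcs C_subset by blast
  have N: "neighbours G r = (neighbours G r \<inter> R) \<union> T"
    unfolding neighbours_root T_def R_def by auto
  have fin: "finite (neighbours G r)" by (rule neighbours_subset(2)[OF G])
  \<comment> \<open>the eigenvalue equations at the root\<close>
  have "alpha_op \<alpha> G x r = alpha_op \<alpha> P.D (x \<circ> P.pl) W2" using eig[OF root(1)] eig_D[of W2] by simp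
  also have "\<dots> = sum g (R \<union> {cs ! 0, cs ! 1})" unfolding P.op_W2 N' g_def by (rule refl)
  finally have "sum g (neighbours G r) = sum g (R \<union> {cs ! 0, cs ! 1})"
    unfolding alpha_op_def g_def .
  also have "\<dots> = sum g R + (g (cs ! 0) + g (cs ! 1))"
    using finite_R c01 c_ne by (subst sum.union_disjoint) (auto simp: R_def)
  also have "sum g (neighbours G r) = sum g (neighbours G r \<inter> R) + sum g T"
    by (subst N, rule sum.union_disjoint) (use fin finite_R in \<open>auto simp: T_def R_def\<close>)
  finally have eq: "sum g (neighbours G r \<inter> R) + sum g T = sum g R + (g (cs ! 0) + g (cs ! 1))" .
  have RV: "R \<subseteq> pverts G" by (auto simp: R_def)
  have g_nonneg: "0 \<le> g w" if "w \<in> pverts G" for w using g_pos[OF that] by simp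
  have leR: "sum g (neighbours G r \<inter> R) \<le> sum g R"
    using finite_R RV g_nonneg by (intro sum_mono2) auto
  have leT: "sum g T \<le> (\<Sum>k<card T. g (cs ! k))"
    unfolding g_def using \<alpha> xr
    by (intro sum_subset_C_le) (auto simp: T_def mono_def mult_left_mono)
  have T_tops: "(t \<in> chain p i \<and> t = anc p (i - 1)) \<or> (t \<in> chain q j \<and> t = anc q (j - 1))" if "t \<in> T" for t
  proof -
    have "par t = r" "t \<in> C" using that by (auto simp: T_def neighbours_root)
    moreover have "r \<notin> chain p i" "r \<notin> chain q j"
      using chain_subset[OF pq(1) ij(2)] chain_subset[OF pq(2) ij(3)] by auto
    ultimately show ?thesis
      using chain_top[OF pq(1) ij(2)] chain_top[OF pq(2) ij(3)] cs(2) by auto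
  qed
  have T_sub: "T \<subseteq> {anc p (i - 1), anc q (j - 1)}" using T_tops by auto
  then have card_T: "card T \<le> 2"
    using card_mono[OF _ T_sub] by (simp add: card_insert_if split: if_splits)
  have gc: "0 < g (cs ! 0)" "0 < g (cs ! 1)" using c01 C_subset g_pos by auto
  have "\<not> card T \<le> 1"
  proof
    assume "card T \<le> 1"
    then have "(\<Sum>k<card T. g (cs ! k)) \<le> g (cs ! 0)"
      using gc by (cases "card T") (auto simp: le_Suc_eq)
    then show False using leT leR eq gc by linarith
  qed
  then have card2: "card T = 2" using card_T by simp
  then have leT2: "sum g T \<le> g (cs ! 0) + g (cs ! 1)" using leT by (simp add: numeral_2_eq_2)
  then have sums: "sum g (neighbours G r \<inter> R) = sum g R" "sum g T = g (cs ! 0) + g (cs ! 1)"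
    using leR eq by linarith+
  have R_sub: "R \<subseteq> neighbours G r"
  proof
    fix w assume w: "w \<in> R"
    show "w \<in> neighbours G r"
    proof (rule ccontr)
      assume "w \<notin> neighbours G r"
      then have "sum g (neighbours G r \<inter> R) < sum g R"
        using w finite_R RV g_nonneg g_pos by (intro sum_strict_mono2[of _ _ w]) auto
      then show False using sums by simp
    qed
  qed
  then show "par w = r" if "w \<in> R" for w using that by (auto simp: neighbours_root)
  have T_eq: "T = {anc p (i - 1), anc q (j - 1)}" "anc p (i - 1) \<noteq> anc q (j - 1)"
  proof -
    show ne: "anc p (i - 1) \<noteq> anc q (j - 1)"
    proof
      assume "anc p (i - 1) = anc q (j - 1)"
      then have "card T \<le> 1" using card_mono[OF _ T_sub] by simp
      then show False using card2 by simp
    qed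
    show "T = {anc p (i - 1), anc q (j - 1)}"
      using T_sub ne card2 by (intro card_subset_eq) auto
  qed
  have ta: "anc p (i - 1) \<in> T" and tb: "anc q (j - 1) \<in> T" using T_eq by auto
  show "par (anc p (i - 1)) = r" "par (anc q (j - 1)) = r"
    using ta tb by (auto simp: T_def neighbours_root)
  have "anc p (i - 1) \<in> chain p i" "anc q (j - 1) \<in> chain q j"
    using T_tops[OF ta] T_tops[OF tb] T_eq(2) by auto
  then show "0 < i" "0 < j" by (auto simp: chain_def)
  have "sum g T = g (anc p (i - 1)) + g (anc q (j - 1))" unfolding T_eq(1) using T_eq(2) by simp
  then have "(1 - \<alpha>) * (x (anc p (i - 1)) + x (anc q (j - 1))) = (1 - \<alpha>) * (x (cs ! 0) + x (cs ! 1))"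
    using sums(2) by (simp add: g_def algebra_simps)
  then show "x (anc p (i - 1)) + x (anc q (j - 1)) = x (cs ! 0) + x (cs ! 1)" using \<alpha> by simp
  have "insert v T \<subseteq> neighbours G r" using R_sub v_in_R by (auto simp: T_def)
  moreover have "card (insert v T) = 3"
    using card2 v_in_R by (subst card_insert_disjoint) (auto simp: T_def R_def intro: card_ge_0_finite)
  ultimately show "3 \<le> card (neighbours G r)" using card_mono[OF fin] by metis
qed

lemma rho_gt_2: "2 < \<rho>"
  by (rule alpha_spectral_radius_gt_2[OF \<alpha> deg_root])

text \<open>
  Otherwise the eigenvalue equation at \<open>w\<close> would bound the spectral radius by the degree of \<open>w\<close>,
  although it is greater than 2.
\<close>

lemma low_degree_less_max:
  assumes w: "w \<in> pverts G" and deg: "card (neighbours G w) \<le> 2"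
  shows "x w < x r"
proof (rule ccontr)
  assume "\<not> x w < x r"
  then have eq: "x w = x r" using x_max[OF w] by simp
  have xr: "0 < x r" using x_pos root by simp
  have "\<rho> * x r = (\<Sum>t\<in>neighbours G w. \<alpha> * x r + (1 - \<alpha>) * x t)"
    using eig[OF w] unfolding alpha_op_def eq by simp
  also have "\<dots> \<le> (\<Sum>t\<in>neighbours G w. x r)"
  proof (rule sum_mono)
    fix t assume "t \<in> neighbours G w"
    then have "x t \<le> x r" using neighbours_subset(1)[OF G] x_max by blast
    then have "(1 - \<alpha>) * x t \<le> (1 - \<alpha>) * x r" using \<alpha> by (intro mult_left_mono) auto
    then show "\<alpha> * x r + (1 - \<alpha>) * x t \<le> x r" by (simp add: algebra_simps)
  qed
  also have "\<dots> \<le> 2 * x r" using deg xr by simp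
  finally show False using rho_gt_2 xr by simp
qed

lemma par_in_chain:
  "t \<in> chain p i \<Longrightarrow> par t = r \<or> par t \<in> chain p i"
  "t \<in> chain q j \<Longrightarrow> par t = r \<or> par t \<in> chain q j"
  using chain_top[OF pq(1) ij(2)] chain_top[OF pq(2) ij(3)] tops by metis+

definition children :: "'a \<Rightarrow> 'a set" where
  "children w = {t \<in> pverts G - {r}. par t = w}"

lemma neighbours_nonroot:
  assumes "w \<in> pverts G - {r}"
  shows "neighbours G w = insert (par w) (children w) \<union> (if w = u then {v} else {}) \<union> (if w = v then {u} else {})"
  using neighbours_eq[of w] assms unfolding children_def by auto

lemma children_R:
  assumes "w \<in> R"
  shows "children w = {}"
proof -
  have w: "w \<noteq> r" "w \<notin> chain p i" "w \<notin> chain q j" using assms cs(2) by (auto simp: R_def)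
  have "par t \<noteq> w" if t: "t \<in> pverts G - {r}" for t
  proof -
    consider "t \<in> R" | "t \<in> chain p i" | "t \<in> chain q j" using t cs(2) by (auto simp: R_def)
    then show ?thesis using rest_par par_in_chain w by cases metis+
  qed
  then show ?thesis by (auto simp: children_def)
qed

lemma children_C:
  assumes "w \<in> C" "t \<in> children w"
  shows "t \<in> C" "children w = {t}"
proof -
  have wr: "w \<noteq> r" using assms(1) C_subset by auto
  have in_C: "t \<in> C" if "t \<in> children w" for t
    using that rest_par wr by (auto simp: children_def R_def)
  show "t \<in> C" by (rule in_C[OF assms(2)])
  have "t' = t" if t': "t' \<in> children w" for t'
  proof -
    have e: "par t = w" "par t' = w" using assms(2) t' by (auto simp: children_def)
    have "(t \<in> chain p i \<and> t' \<in> chain p i) \<or> (t \<in> chain q j \<and> t' \<in> chain q j)"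
      using in_C[OF assms(2)] in_C[OF t'] par_in_chain e wr disjoint_chains cs(2)
      by (metis UnE disjoint_iff)
    then show ?thesis
      using inj_onD[OF inj_on_par_chain[OF pq(1) ij(2)]] inj_onD[OF inj_on_par_chain[OF pq(2) ij(3)]] e
      by metis
  qed
  then show "children w = {t}" using assms(2) by blast
qed

lemma low_degree_C:
  assumes w: "w \<in> C" "w \<noteq> u"
  shows "card (neighbours G w) \<le> 2"
proof -
  have wv: "w \<noteq> v" using w v_not_in_chains cs(2) by auto
  have N: "neighbours G w = insert (par w) (children w)"
    using neighbours_nonroot[of w] w wv C_subset by auto
  show ?thesis
  proof (cases "children w = {}")
    case True
    then show ?thesis unfolding N by simp
  next
    case False
    then obtain t where "t \<in> children w" by blast
    then have "children w = {t}" by (rule children_C(2)[OF w(1)])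
    then show ?thesis unfolding N by (simp add: card_insert_if)
  qed
qed

lemma row_v: "\<rho> * x v = 2 * \<alpha> * x v + (1 - \<alpha>) * (x r + x u)"
proof -
  have "neighbours G v = {r, u}"
    using neighbours_nonroot[of v] extra children_R[OF v_in_R] rest_par[OF v_in_R] by auto
  then show ?thesis using eig[OF u_in(2)] extra by (simp add: alpha_op_def algebra_simps)
qed

text \<open>
  Suppose \<open>d \<ge> 3\<close>. In \<open>G\<close> the neighbours of \<open>u\<close> are \<open>r\<close> and \<open>v\<close>. In the extremal graph \<open>u\<close> is placed either at
  a pendant vertex, where it loses \<open>v\<close>, or at \<open>W3\<close>, where it gains a child. Both contradict the equality
  of the eigenvalue equations at \<open>u\<close>.
\<close>

lemma u_not_in_C_imp_d2:
  assumes u: "u \<notin> C"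
  shows "d = 2"
proof (rule ccontr)
  assume "d \<noteq> 2"
  then have d3: "3 \<le> d" using ij(4) by simp
  have uR: "u \<in> R" using u extra by (simp add: R_def)
  have "neighbours G u = {r, v}"
    using neighbours_nonroot[of u] extra children_R[OF uR] rest_par[OF uR] by auto
  then have row: "\<rho> * x u = 2 * \<alpha> * x u + (1 - \<alpha>) * (x r + x v)"
    using eig[OF u_in(1)] extra by (simp add: alpha_op_def algebra_simps)
  have pos: "0 < x u" "0 < x v" using x_pos u_in by auto
  from ys_cases show False
  proof
    assume "ys = cs \<and> x u \<le> x (cs ! 0)"
    then have "u \<in> set zs" using P.V u extra by auto
    then obtain k where k: "k < s" "zs ! k = u" using P.zs by (auto simp: in_set_conv_nth)
    have "\<rho> * x u = \<alpha> * x u + (1 - \<alpha>) * x r"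
      using P.op_Pendant[of "Suc k" \<alpha> x] eig_D[of "Pendant (Suc k)"] k by simp
    then have "\<alpha> * x u + (1 - \<alpha>) * x v = 0" using row by (simp add: algebra_simps)
    moreover have "0 \<le> \<alpha> * x u" "0 < (1 - \<alpha>) * x v" using pos \<alpha> by auto
    ultimately show False by linarith
  next
    assume ys: "ys = cs[0 := u] \<and> u \<notin> C"
    then have y0: "ys ! 0 = u" and y2: "ys ! 2 = cs ! 2" using length_cs ij(4) by auto
    have "\<rho> * x u = 3 * \<alpha> * x u + (1 - \<alpha>) * (x r + x v + x (cs ! 2))"
      using P.op_W3[OF d3, of \<alpha> x] eig_D[of W3] unfolding y0 y2 by (simp add: y0)
    then have "\<alpha> * x u + (1 - \<alpha>) * x (cs ! 2) = 0" using row by (simp add: algebra_simps)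
    moreover have "0 < x (cs ! 2)" using x_pos cs_in[of 2] C_subset d3 by auto
    moreover have "0 \<le> \<alpha> * x u" using pos \<alpha> by auto
    ultimately show False using \<alpha> by (smt (verit) mult_pos_pos)
  qed
qed

lemma ys_eq: "u \<in> C \<Longrightarrow> ys = cs"
  using ys_cases by blast

text \<open>
  Compare the eigenvalue equations at \<open>v\<close>, which is placed at \<open>W1\<close>.
\<close>

lemma x_u_eq: "u \<in> C \<Longrightarrow> x u = x (cs ! 0)"
proof -
  assume u: "u \<in> C"
  have "\<rho> * x v = 2 * \<alpha> * x v + (1 - \<alpha>) * (x r + x (cs ! 0))"
    using P.op_W1[of \<alpha> x] eig_D[of W1] ys_eq[OF u] by simp
  then have "(1 - \<alpha>) * x u = (1 - \<alpha>) * x (cs ! 0)" using row_v by (simp add: algebra_simps)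
  then show ?thesis using \<alpha> by simp
qed

lemma C_eq_tops_if_d2:
  assumes "d = 2"
  shows "C = {anc p (i - 1), anc q (j - 1)}"
proof -
  have "i = 1" "j = 1" using tops(1,2) ij(1) assms by auto
  then show ?thesis unfolding cs(2) chain_def by auto
qed

text \<open>
  Suppose the parent of \<open>u\<close> is on its chain. Comparing \<open>u\<close> with \<open>W3\<close>, which has the same value, shows that
  \<open>u\<close> has a child \<open>t\<close> and that the values at \<open>par u\<close> and \<open>t\<close> add up to those at \<open>r\<close> and \<open>cs ! 2\<close>. As \<open>u\<close>,
  \<open>par u\<close>, \<open>t\<close> are three different chain vertices, this is only possible if \<open>cs ! 0\<close> and \<open>cs ! 1\<close> both have
  the maximal value \<open>x r\<close>. One of the two is different from \<open>u\<close> and thus has degree at most 2, against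
  \<open>low_degree_less_max\<close>.
\<close>

lemma par_u:
  assumes u: "u \<in> C"
  shows "par u = r"
proof (rule ccontr)
  assume ne: "par u \<noteq> r"
  have "d \<noteq> 2" using C_eq_tops_if_d2 tops ne u by auto
  then have d3: "3 \<le> d" using ij(4) by simp
  have uv: "u \<noteq> v" "u \<in> pverts G - {r}" using extra by auto
  have N: "neighbours G u = insert (par u) (insert v (children u))"
    using neighbours_nonroot[OF uv(2)] uv by auto
  have pos: "0 < x u" "0 < x v" "0 < x (cs ! 2)"
    using x_pos u_in cs_in[of 2] C_subset d3 by auto
  have W3: "\<rho> * x u = 3 * \<alpha> * x u + (1 - \<alpha>) * (x r + x v + x (cs ! 2))"
    using P.op_W3[OF d3, of \<alpha> x] eig_D[of W3] ys_eq[OF u] x_u_eq[OF u] by simp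
  have parC: "par u \<in> C" using par_in_chain u ne cs(2) by auto
  have par_v: "par u \<noteq> v" using extra by simp
  have x_par: "x (par u) \<le> x r" using x_max parC C_subset by auto
  show False
  proof (cases "children u = {}")
    case True
    have "\<rho> * x u = 2 * \<alpha> * x u + (1 - \<alpha>) * (x (par u) + x v)"
      using eig[OF u_in(1)] par_v by (simp add: alpha_op_def N True algebra_simps)
    then have "\<alpha> * x u + (1 - \<alpha>) * (x r - x (par u) + x (cs ! 2)) = 0" using W3 by (simp add: algebra_simps)
    moreover have "0 \<le> \<alpha> * x u" "0 < (1 - \<alpha>) * (x r - x (par u) + x (cs ! 2))"
      using pos \<alpha> x_par by auto
    ultimately show False by linarith
  next
    case False
    then obtain t where t: "t \<in> children u" by blast
    have tC: "t \<in> C" and ch: "children u = {t}" using children_C[OF u t] by auto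
    have "par t = u" "t \<in> pverts G - {r}" using t by (auto simp: children_def)
    then have "lev t = Suc (lev u)" using lev[of t] by simp
    moreover have "lev u = Suc (lev (par u))" using lev[of u] uv(2) by blast
    ultimately have "lev t \<noteq> lev (par u)" "lev t \<noteq> lev u" "lev u \<noteq> lev (par u)" by simp_all
    then have tne: "t \<noteq> par u" "t \<noteq> u" "u \<noteq> par u" by metis+
    have tv: "t \<noteq> v" using tC v_not_in_chains cs(2) by auto
    have "\<rho> * x u = 3 * \<alpha> * x u + (1 - \<alpha>) * (x (par u) + x v + x t)"
      using eig[OF u_in(1)] par_v tne tv by (auto simp: alpha_op_def N ch algebra_simps)
    then have "(1 - \<alpha>) * (x (par u) + x t) = (1 - \<alpha>) * (x r + x (cs ! 2))"
      using W3 by (simp add: algebra_simps)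
    then have e: "x (par u) + x t = x r + x (cs ! 2)" using \<alpha> by simp
    \<comment> \<open>three chain vertices weigh at most as much as the first three of the sorted list\<close>
    have "(\<Sum>w\<in>{u, par u, t}. x w) \<le> (\<Sum>k<card {u, par u, t}. x (cs ! k))"
      using u parC tC by (intro sum_subset_C_le[where h = "\<lambda>z. z"]) (auto simp: mono_def)
    moreover have "card {u, par u, t} = 3" using tne by simp
    ultimately have "x u + (x (par u) + x t) \<le> x (cs ! 0) + x (cs ! 1) + x (cs ! 2)"
      using tne by (simp add: numeral_3_eq_3 numeral_2_eq_2)
    then have "x r \<le> x (cs ! 1)" using e x_u_eq[OF u] by simp
    moreover have "x (cs ! 1) \<le> x (cs ! 0)" using x_cs_antimono[of 0 1] d3 by simp
    ultimately have big: "x r \<le> x (cs ! 0)" "x r \<le> x (cs ! 1)" by auto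
    have c: "cs ! 0 \<in> C" "cs ! 1 \<in> C" "cs ! 0 \<noteq> cs ! 1" using cs_in cs_inj[of 0 1] d3 by auto
    have small: "x w < x r" if "w \<in> C" "w \<noteq> u" for w
      using low_degree_less_max low_degree_C[OF that] that C_subset by blast
    show False using small[OF c(1)] small[OF c(2)] c(3) big by fastforce
  qed
qed

lemma swap_chains: "tight_unicyclic G r par lev u v q p j i d x \<alpha> cs ys zs s a b"
proof (rule tight_unicyclic.intro)
  show "two_chain_unicyclic G r par lev u v q p j i d x \<alpha> cs"
  proof (rule two_chain_unicyclic.intro[OF bfs_unicyclic_axioms], rule two_chain_unicyclic_axioms.intro)
    show "j + i = d" using ij(1) by simp
    show "chain q j \<inter> chain p i = {}" using disjoint_chains by blast
    show "v \<notin> chain q j \<union> chain p i" using v_not_in_chains by blast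
    show "C = chain q j \<union> chain p i" using cs(2) by blast
  qed (fact pq ij \<alpha> cs x_pos x_max)+
  show "placement (pverts G) r v ys zs s a b d" by (rule P.placement_axioms)
  show "tight_unicyclic_axioms G r u v x \<alpha> cs ys zs s a b"
    by (rule tight_unicyclic_axioms.intro[OF ys_cases eig eig_D])
qed

text \<open>
  Here \<open>r\<close> is adjacent to every other vertex, so any vertex other than \<open>u\<close> and \<open>v\<close> can play \<open>PathA 1\<close>.
\<close>

lemma iso_if_d2:
  assumes u: "u \<notin> C"
  shows "digraph_iso (with_proj G) (with_proj (Delta2 (card (pverts G) - d - 2) (d div 2) ((d - 1) div 2)))"
proof -
  have d2: "d = 2" by (rule u_not_in_C_imp_d2[OF u])
  define t where "t = anc p (i - 1)"
  have C: "C = {t, anc q (j - 1)}" unfolding t_def by (rule C_eq_tops_if_d2[OF d2])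
  have par_r: "par w = r" if w: "w \<in> pverts G - {r}" for w
  proof (cases "w \<in> C")
    case True
    then have "w = anc p (i - 1) \<or> w = anc q (j - 1)" unfolding C t_def by simp
    then show ?thesis using tops(3,4) by metis
  next
    case False
    then show ?thesis using w by (intro rest_par) (simp add: R_def)
  qed
  have tC: "t \<in> C" using C by simp
  have tu: "t \<noteq> u" "t \<noteq> v" using tC u v_not_in_chains cs(2) by auto
  have "d + 2 \<le> card (pverts G)"
  proof -
    have "insert r (insert v C) \<subseteq> pverts G" using root extra C_subset by auto
    moreover have "card (insert r (insert v C)) = d + 2"
      using extra C_subset v_in_R distinct_card[OF cs(1)] length_cs by (auto simp: card_insert_if R_def)
    ultimately show ?thesis using card_mono[OF finite_verts] by metis
  qed
  moreover have "t \<in> pverts G - {r}" using tC C_subset by auto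
  ultimately obtain zs' where pl: "placement (pverts G) r v [u, t] zs' (card (pverts G) - d - 2) (d div 2) ((d - 1) div 2) d"
    using placement_exists[OF finite_verts refl, of d "[u, t]" r v] d2 tu extra root by auto
  have "rooted_unicyclic G r par lev ([u, t] ! 0) v" using rooted_unicyclic_axioms by simp
  then show ?thesis
    using pl
  proof (rule iso_Delta2I)
    fix k assume "k < d"
    then have "k = 0 \<or> k = 1" using d2 by auto
    then show "par ([u, t] ! k) = spine_parent r [u, t] k"
      using par_r extra \<open>t \<in> pverts G - {r}\<close> by (auto simp: spine_parent_def)
  qed (use par_r in auto)
qed

text \<open>
  By \<open>par_u\<close> the vertex \<open>u\<close> is the top of its chain, so the top of the other chain has the value at
  \<open>PathA 1\<close>. That chain is a pendant path of \<open>G\<close> and by \<open>pendant_path_length_le\<close> as long as the path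
  \<open>PathA\<close>. Then the first chain is as long as \<open>W3\<close> and \<open>PathB\<close> together.
\<close>

lemma iso_if_u_in_first_chain:
  assumes u: "u \<in> chain p i"
  shows "digraph_iso (with_proj G) (with_proj (Delta2 (card (pverts G) - d - 2) (d div 2) ((d - 1) div 2)))"
proof -
  have uC: "u \<in> C" using u cs(2) by simp
  have r_not: "r \<notin> chain p i" using chain_subset[OF pq(1) ij(2)] by auto
  have u_top: "u = anc p (i - 1)"
    using chain_top[OF pq(1) ij(2) u] par_u[OF uC] r_not by simp
  have x_top: "x (anc q (j - 1)) = x (cs ! 1)"
    using top_values x_u_eq[OF uC] u_top by simp
  have anc_p: "anc p i = r" and anc_q: "anc q j = r"
    using tops anc_Suc[of p "i - 1"] anc_Suc[of q "j - 1"] by auto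
  \<comment> \<open>the chains numbered from the root, which gets the number 0\<close>
  define A where "A k = anc p (i - k)" for k
  define B where "B k = anc q (j - k)" for k
  have A0: "A 0 = r" and B0: "B 0 = r" using anc_p anc_q by (simp_all add: A_def B_def)
  have parA: "par (A k) = A (k - 1)" if "1 \<le> k" "k \<le> i" for k
    unfolding A_def using that anc_Suc[of p "i - k"] by (simp add: Suc_diff_le)
  have parB: "par (B k) = B (k - 1)" if "1 \<le> k" "k \<le> j" for k
    unfolding B_def using that anc_Suc[of q "j - k"] by (simp add: Suc_diff_le)
  have A_in: "A k \<in> chain p i" if "1 \<le> k" "k \<le> i" for k
    using that by (auto simp: A_def chain_def)
  have B_in: "B k \<in> chain q j" if "1 \<le> k" "k \<le> j" for k
    using that by (auto simp: B_def chain_def)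
  have chain_A: "\<exists>k. 1 \<le> k \<and> k \<le> i \<and> w = A k" if w: "w \<in> chain p i" for w
  proof -
    obtain l where "l < i" "w = anc p l" using w by (auto simp: chain_def)
    then show ?thesis by (intro exI[of _ "i - l"]) (auto simp: A_def)
  qed
  have chain_B: "\<exists>k. 1 \<le> k \<and> k \<le> j \<and> w = B k" if w: "w \<in> chain q j" for w
  proof -
    obtain l where "l < j" "w = anc q l" using w by (auto simp: chain_def)
    then show ?thesis by (intro exI[of _ "j - l"]) (auto simp: B_def)
  qed
  have lev_q: "lev q = j"
    using anc_q anc_not_root[OF pq(2), of j] ij(3) by (cases "j = lev q") auto
  have levB: "lev (B k) = k" if "k \<le> j" for k
    using anc_lev[OF pq(2), of "j - k"] lev_q that by (simp add: B_def)
  have chB: "children (B k) = (if k < j then {B (k + 1)} else {})" if k: "1 \<le> k" "k \<le> j" for k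
  proof -
    have BC: "B k \<in> C" using B_in[OF k] cs(2) by simp
    have Br: "B k \<noteq> r" using BC C_subset by auto
    have sub: "\<exists>l. 1 \<le> l \<and> l \<le> j \<and> t = B l \<and> l = Suc k" if t: "t \<in> children (B k)" for t
    proof -
      have tC: "t \<in> chain p i \<union> chain q j" using children_C(1)[OF BC t] unfolding cs(2) .
      have "par t = B k" using t by (simp add: children_def)
      have "t \<notin> chain p i"
      proof
        assume "t \<in> chain p i"
        then have "B k \<in> chain p i" using par_in_chain(1)[of t] \<open>par t = B k\<close> Br by simp
        then show False using B_in[OF k] disjoint_chains by blast
      qed
      with tC have "t \<in> chain q j" by simp
      from chain_B[OF this] obtain l where l: "1 \<le> l" "l \<le> j" "t = B l" by (elim exE conjE)
      have "B (l - 1) = B k" using parB[OF l(1,2)] \<open>par t = B k\<close> unfolding l(3) by (rule trans[OF sym])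
      moreover have "lev (B (l - 1)) = l - 1" using l(2) by (intro levB) linarith
      moreover have "lev (B k) = k" by (rule levB[OF k(2)])
      ultimately have "l - 1 = k" by metis
      then have "l = Suc k" using l(1) by linarith
      then show ?thesis using l by blast
    qed
    show ?thesis
    proof (cases "k < j")
      case True
      have "B (k + 1) \<in> children (B k)"
        using True parB[of "k + 1"] subsetD[OF chain_subset[OF pq(2) ij(3)] B_in[of "k + 1"]]
        unfolding children_def by simp
      from children_C(2)[OF BC this] show ?thesis using True by simp
    next
      case False
      then have "children (B k) = {}" using sub k by (metis Suc_leD all_not_in_conv le_antisym not_less_eq_eq order_refl leI)
      then show ?thesis using False by simp
    qed
  qed
  have rowB: "\<rho> * x (B k) = (if k < j then 2 else 1) * \<alpha> * x (B k)
      + (1 - \<alpha>) * (x (B (k - 1)) + (if k < j then x (B (k + 1)) else 0))" if k: "1 \<le> k" "k \<le> j" for k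
  proof -
    have Bq: "B k \<in> chain q j" by (rule B_in[OF k])
    have in_V: "B k \<in> pverts G - {r}" by (rule subsetD[OF chain_subset[OF pq(2) ij(3)] Bq])
    have "B k \<noteq> u" using u disjoint_chains Bq by blast
    moreover have "B k \<noteq> v" using v_not_in_chains Bq by blast
    ultimately have N: "neighbours G (B k) = insert (B (k - 1)) (if k < j then {B (k + 1)} else {})"
      using neighbours_nonroot[OF in_V] unfolding chB[OF k] parB[OF k] by simp
    have row: "\<rho> * x (B k) = alpha_op \<alpha> G x (B k)" using eig[of "B k"] in_V by simp
    show ?thesis
    proof (cases "k < j")
      case True
      have "lev (B (k - 1)) = k - 1" "lev (B (k + 1)) = k + 1" using True by (intro levB; linarith)+
      then have "B (k - 1) \<noteq> B (k + 1)" by (metis add_eq_if diff_le_self le_add1 not_less_eq_eq order_refl Suc_eq_plus1 le_trans)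
      then show ?thesis using True unfolding row alpha_op_def N by (simp add: algebra_simps)
    next
      case False
      then show ?thesis unfolding row alpha_op_def N by (simp add: algebra_simps)
    qed
  qed
  define Y where "Y k = (if k = 0 then x r else x (cs ! (2 * k - 1)))" for k
  have rowY: "\<rho> * Y k = (if k < a then 2 else 1) * \<alpha> * Y k
      + (1 - \<alpha>) * (Y (k - 1) + (if k < a then Y (k + 1) else 0))" if "1 \<le> k" "k \<le> a" for k
  proof -
    have "alpha_op \<alpha> P.D (x \<circ> P.pl) (PathA k) = \<rho> * x (ys ! (2 * k - 1))"
      using eig_D[of "PathA k"] that by simp
    then show ?thesis
      using P.op_PathA[OF that, of \<alpha> x] that unfolding ys_eq[OF uC] Y_def by auto
  qed
  have Y_pos: "0 < Y k" if k: "k \<le> a" for k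
  proof (cases "k = 0")
    case True
    then show ?thesis using x_pos root by (simp add: Y_def)
  next
    case False
    then have "2 * k - 1 < d" using k P.ab(1) by linarith
    from cs_in[OF this] have "cs ! (2 * k - 1) \<in> pverts G" using C_subset by blast
    then show ?thesis using x_pos False by (simp add: Y_def)
  qed
  have X_pos: "0 < x (B k)" if "k \<le> j" for k
    using that x_pos root B0 B_in[of k] chain_subset[OF pq(2) ij(3)] by (cases "k = 0") auto
  have start: "x (B 0) = Y 0" "x (B 1) = Y 1"
    using B0 x_top by (auto simp: Y_def B_def)
  have a1: "1 \<le> a" using P.ab P.d by simp
  have j1: "1 \<le> j" using tops(2) by simp
  have "a \<le> j"
    by (rule pendant_path_length_le[where X = "\<lambda>k. x (B k)", OF \<alpha> j1 start rowB rowY Y_pos])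
  moreover have "j \<le> a"
    by (rule pendant_path_length_le[where Y = "\<lambda>k. x (B k)", OF \<alpha> a1 start[symmetric] rowY rowB X_pos])
  ultimately have j: "j = d div 2" using P.ab by simp
  then have i: "i = d - d div 2" using ij(1) by simp
  \<comment> \<open>alternate between the chains, in the numbering of the spine\<close>
  define ys' where "ys' = map (\<lambda>k. if even k then A (k div 2 + 1) else B ((k + 1) div 2)) [0..<d]"
  have len: "length ys' = d" by (simp add: ys'_def)
  have nth: "ys' ! k = (if even k then A (k div 2 + 1) else B ((k + 1) div 2))" if "k < d" for k
    using that by (simp add: ys'_def)
  have idx_even: "1 \<le> k div 2 + 1 \<and> k div 2 + 1 \<le> i" if "k < d" "even k" for k
    using that unfolding i by presburger
  have idx_odd: "1 \<le> (k + 1) div 2 \<and> (k + 1) div 2 \<le> j" if "k < d" "odd k" for k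
    using that unfolding j by presburger
  have set_ys': "set ys' = C"
  proof
    show "set ys' \<subseteq> C"
    proof
      fix w assume "w \<in> set ys'"
      then obtain k where k: "k < d" "w = ys' ! k" using len by (auto simp: in_set_conv_nth)
      show "w \<in> C"
        using A_in idx_even[OF k(1)] B_in idx_odd[OF k(1)] cs(2) unfolding k(2) nth[OF k(1)] by auto
    qed
    show "C \<subseteq> set ys'"
    proof
      fix w assume "w \<in> C"
      then consider "w \<in> chain p i" | "w \<in> chain q j" using cs(2) by auto
      then show "w \<in> set ys'"
      proof cases
        case 1
        then obtain k where k: "1 \<le> k" "k \<le> i" "w = A k" using chain_A by blast
        then have lt: "2 * (k - 1) < d" using i by auto
        have "ys' ! (2 * (k - 1)) = w" unfolding nth[OF lt] using k by simp
        then show ?thesis using lt len nth_mem by metis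
      next
        case 2
        then obtain k where k: "1 \<le> k" "k \<le> j" "w = B k" using chain_B by blast
        then have lt: "2 * k - 1 < d" using j ij(4) by auto
        have "odd (2 * k - 1)" "(2 * k - 1 + 1) div 2 = k" using k by auto
        then have "ys' ! (2 * k - 1) = w" unfolding nth[OF lt] using k by simp
        then show ?thesis using lt len nth_mem by metis
      qed
    qed
  qed
  have dist: "distinct ys'"
    using set_ys' len distinct_card[OF cs(1)] length_cs by (intro card_distinct) simp
  have y0: "ys' ! 0 = u" using nth[of 0] ij(4) u_top by (simp add: A_def)
  have "d + 2 \<le> card (pverts G)"
  proof -
    have "insert r (insert v C) \<subseteq> pverts G" using root extra C_subset by auto
    moreover have "card (insert r (insert v C)) = d + 2"
      using extra C_subset v_in_R distinct_card[OF cs(1)] length_cs by (auto simp: card_insert_if R_def)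
    ultimately show ?thesis using card_mono[OF finite_verts] by metis
  qed
  then obtain zs' where pl: "placement (pverts G) r v ys' zs' (card (pverts G) - d - 2) (d div 2) ((d - 1) div 2) d"
    using placement_exists[OF finite_verts refl ij(4), of ys' r v] dist len set_ys' C_subset root v_in_R
    by (auto simp: R_def)
  have "rooted_unicyclic G r par lev (ys' ! 0) v" unfolding y0 by (rule rooted_unicyclic_axioms)
  then show ?thesis
    using pl
  proof (rule iso_Delta2I)
    fix k assume k: "k < d"
    show "par (ys' ! k) = spine_parent r ys' k"
    proof (cases "even k")
      case True
      then obtain l where l: "k = 2 * l" by blast
      then have "par (ys' ! k) = A l" using nth[OF k] parA[of "l + 1"] idx_even[OF k] by simp
      moreover have "spine_parent r ys' k = A l"
        using l k nth[of "k - 2"] A0 by (cases l) (auto simp: spine_parent_def)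
      ultimately show ?thesis by simp
    next
      case False
      then obtain l where l: "k = 2 * l + 1" using oddE by blast
      then have "par (ys' ! k) = B l" using nth[OF k] parB[of "l + 1"] idx_odd[OF k] by simp
      moreover have "spine_parent r ys' k = B l"
        using l k nth[of "k - 2"] B0 by (cases l) (auto simp: spine_parent_def)
      ultimately show ?thesis by simp
    qed
  next
    fix w assume "w \<in> pverts G - {r} - set ys'"
    then show "par w = r" using rest_par set_ys' by (simp add: R_def)
  qed
qed

lemma iso_U2_star:
  "digraph_iso (with_proj G) (with_proj (Delta2 (card (pverts G) - d - 2) (d div 2) ((d - 1) div 2)))"
proof -
  consider "u \<notin> C" | "u \<in> chain p i" | "u \<in> chain q j" using cs(2) by blast
  then show ?thesis
  proof cases
    case 1
    then show ?thesis by (rule iso_if_d2)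
  next
    case 2
    then show ?thesis by (rule iso_if_u_in_first_chain)
  next
    case 3
    then show ?thesis by (rule tight_unicyclic.iso_if_u_in_first_chain[OF swap_chains])
  qed
qed

end

section \<open>The extremal graph\<close>

context two_chain_unicyclic
begin

lemma x_le_first: "w \<in> C \<Longrightarrow> x w \<le> x (cs ! 0)"
proof -
  assume "w \<in> C"
  then obtain k where "k < d" "w = cs ! k" using length_cs by (auto simp: in_set_conv_nth)
  then show ?thesis using x_cs_antimono[of 0 k] by simp
qed

lemma placement_dominates:
  obtains ys zs where "placement (pverts G) r v ys zs (card (pverts G) - d - 2) (d div 2) ((d - 1) div 2) d"
    "(ys = cs \<and> x u \<le> x (cs ! 0)) \<or> (ys = cs[0 := u] \<and> u \<notin> C)"
    "alpha_form \<alpha> G x \<le> caterpillar_form ys"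
proof -
  obtain ys where ys: "(ys = cs \<and> x u \<le> x (cs ! 0)) \<or> (ys = cs[0 := u] \<and> u \<notin> C)"
    "alpha_form \<alpha> G x \<le> caterpillar_form ys"
  proof (cases "x u \<le> x (cs ! 0)")
    case True
    then show ?thesis using that[of cs] alpha_form_le_caterpillar by blast
  next
    case False
    then have "u \<notin> C" "x (cs ! 0) < x u" using x_le_first by auto
    then show ?thesis using that[of "cs[0 := u]"] alpha_form_le_caterpillar_exchange by blast
  qed
  have vC: "v \<notin> C" using v_not_in_chains cs(2) by simp
  have "distinct ys \<and> length ys = d \<and> set ys \<subseteq> pverts G - {r} \<and> v \<notin> set ys"
    using ys(1)
  proof
    assume "ys = cs \<and> x u \<le> x (cs ! 0)"
    then show ?thesis using cs(1) length_cs C_subset vC by simp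
  next
    assume y: "ys = cs[0 := u] \<and> u \<notin> C"
    have "set ys \<subseteq> insert u C" using y set_update_subset_insert by fast
    then have "set ys \<subseteq> pverts G - {r}" "v \<notin> set ys" using C_subset vC extra by auto
    moreover have "distinct ys" using y cs(1) by (simp add: distinct_list_update)
    moreover have "length ys = d" using y length_cs by simp
    ultimately show ?thesis by simp
  qed
  moreover have "d + 2 \<le> card (pverts G)"
  proof -
    have "insert r (insert v C) \<subseteq> pverts G" using root extra C_subset by auto
    moreover have "card (insert r (insert v C)) = d + 2"
      using extra C_subset vC distinct_card[OF cs(1)] length_cs by (auto simp: card_insert_if)
    ultimately show ?thesis using card_mono[OF finite_verts] by metis
  qed
  ultimately obtain zs where
    "placement (pverts G) r v ys zs (card (pverts G) - d - 2) (d div 2) ((d - 1) div 2) d"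
    using placement_exists[OF finite_verts refl ij(4), of ys r v] root extra by auto
  then show ?thesis using that ys by blast
qed

end

lemma (in rooted_unicyclic) swap_extra: "rooted_unicyclic G r par lev v u"
proof (rule rooted_unicyclic.intro)
  show "(s, t) \<in> parcs G \<longleftrightarrow>
      (s \<in> pverts G \<and> s \<noteq> r \<and> t = par s) \<or> (t \<in> pverts G \<and> t \<noteq> r \<and> s = par t)
      \<or> (s = v \<and> t = u) \<or> (s = u \<and> t = v)" for s t
    unfolding arcs_iff by blast
  show "v \<noteq> u" using extra by simp
qed (fact G root par lev extra)+

text \<open>
  The roles of the two ends of the extra edge can be interchanged, so that \<open>v\<close> is off the chains.
\<close>

lemma two_chain_representation:
  fixes G :: "'a pair_pre_digraph"
  assumes uni: "unicyclic G" and d: "graph_diameter G = ereal (real d)" "2 \<le> d"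
    and \<alpha>: "0 \<le> \<alpha>" "\<alpha> < 1" and pos: "\<And>w. w \<in> pverts G \<Longrightarrow> 0 < x w"
  obtains r par lev u v p q i j cs where "two_chain_unicyclic G r par lev u v p q i j d x \<alpha> cs"
proof -
  have G: "pair_graph G" using uni by (simp add: unicyclic_def)
  interpret pair_graph G by (rule G)
  obtain p q where p: "p \<in> pverts G" and q: "q \<in> pverts G"
    and pq: "\<And>k. (p, q) \<in> parcs G ^^ k \<Longrightarrow> d \<le> k"
    using graph_diameter_attained[OF G d(1)] d(2) by auto
  have "finite (x ` pverts G)" "x ` pverts G \<noteq> {}" using pair_finite_verts p by auto
  then have "Max (x ` pverts G) \<in> x ` pverts G" by (rule Max_in)
  then obtain r where r: "r \<in> pverts G" "x r = Max (x ` pverts G)" by auto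
  have max: "x w \<le> x r" if "w \<in> pverts G" for w
    using that pair_finite_verts unfolding r(2) by (intro Max_ge) auto
  obtain par lev u v where rooted: "rooted_unicyclic G r par lev u v"
    and lev_arc: "\<And>s t. (s, t) \<in> parcs G \<Longrightarrow> lev t \<le> Suc (lev s)"
    using unicyclic_rooted[OF uni r(1)] by metis
  interpret R: bfs_unicyclic G r par lev u v
    by (rule bfs_unicyclic.intro[OF rooted bfs_unicyclic_axioms.intro[OF lev_arc]])
  obtain i j where ij: "i + j = d" "i \<le> lev p" "j \<le> lev q" "R.chain p i \<inter> R.chain q j = {}"
    "\<not> (u \<in> R.chain p i \<union> R.chain q j \<and> v \<in> R.chain p i \<union> R.chain q j)"
    using R.two_chains[OF p q pq] .
  have fin: "finite (R.chain p i \<union> R.chain q j)" by (simp add: R.chain_def)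
  obtain ws where ws: "set ws = R.chain p i \<union> R.chain q j" "distinct ws"
    using finite_distinct_list[OF fin] by blast
  define cs where "cs = sort_key (\<lambda>w. - x w) ws"
  have cs: "distinct cs" "set cs = R.chain p i \<union> R.chain q j"
    using ws by (simp_all add: cs_def)
  have "sorted (map (\<lambda>w. - x w) cs)" unfolding cs_def by (rule sorted_sort_key)
  then have sorted: "sorted_wrt (\<lambda>s t. x t \<le> x s) cs" by (simp add: sorted_map)
  have two_chain: "two_chain_unicyclic G r par lev u' v' p q i j d x \<alpha> cs"
    if "rooted_unicyclic G r par lev u' v'" "v' \<notin> R.chain p i \<union> R.chain q j" for u' v'
  proof -
    interpret R': bfs_unicyclic G r par lev u' v'
      by (rule bfs_unicyclic.intro[OF that(1) bfs_unicyclic_axioms.intro[OF lev_arc]])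
    show ?thesis
      by (rule two_chain_unicyclic.intro[OF R'.bfs_unicyclic_axioms],
          rule two_chain_unicyclic_axioms.intro)
        (fact p q ij d(2) that(2) \<alpha> pos max cs sorted)+
  qed
  show ?thesis
  proof (cases "v \<in> R.chain p i \<union> R.chain q j")
    case True
    then have "u \<notin> R.chain p i \<union> R.chain q j" using ij(5) by blast
    then show ?thesis using that two_chain[OF R.swap_extra] by blast
  next
    case False
    then show ?thesis using that two_chain[OF rooted] by blast
  qed
qed

text \<open>
  If the spectral radius of \<open>G\<close> is not smaller, all the inequalities between the two quadratic forms of
  the Perron vector are equalities, and the transported vector attains the maximum of the Rayleigh
  quotient.
\<close>

lemma alpha_spectral_radius_less_or_iso:
  fixes G :: "'a pair_pre_digraph"
  assumes \<alpha>: "0 \<le> \<alpha>" "\<alpha> < 1" and G: "G \<in> unicyclic_graphs n d" and d: "2 \<le> d"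
  shows "alpha_spectral_radius \<alpha> G
      < alpha_spectral_radius \<alpha> (Delta2 (n - d - 2) (d div 2) ((d - 1) div 2))
    \<or> digraph_iso (with_proj G) (with_proj (Delta2 (n - d - 2) (d div 2) ((d - 1) div 2)))"
    (is "?less \<or> ?iso")
proof (rule disjCI)
  let ?D = "Delta2 (n - d - 2) (d div 2) ((d - 1) div 2)"
  let ?\<rho> = "alpha_spectral_radius \<alpha>"
  assume "\<not> ?iso"
  show ?less
  proof (rule ccontr)
    assume not_less: "\<not> ?less"
    have uni: "unicyclic G" and card: "card (pverts G) = n"
      and diam: "graph_diameter G = ereal (real d)"
      using G by (auto simp: unicyclic_graphs_def)
    have pG: "pair_graph G" and conn: "Digraph_Component.connected (with_proj G)"
      using uni by (auto simp: unicyclic_def)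
    have ne: "pverts G \<noteq> {}"
      using graph_diameter_attained[OF pG diam] d by auto
    obtain x where x: "\<And>w. w \<in> pverts G \<Longrightarrow> 0 < x w"
      "\<And>w. w \<in> pverts G \<Longrightarrow> alpha_op \<alpha> G x w = ?\<rho> G * x w"
      using perron_vector_exists[OF pG conn ne \<alpha>] by metis
    obtain r par lev u v p q i j cs where "two_chain_unicyclic G r par lev u v p q i j d x \<alpha> cs"
      by (rule two_chain_representation[OF uni diam d \<alpha> x(1)])
    then interpret T: two_chain_unicyclic G r par lev u v p q i j d x \<alpha> cs .
    obtain ys zs where pl: "placement (pverts G) r v ys zs (n - d - 2) (d div 2) ((d - 1) div 2) d"
      and ys: "(ys = cs \<and> x u \<le> x (cs ! 0)) \<or> (ys = cs[0 := u] \<and> u \<notin> set cs)"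
      and le: "alpha_form \<alpha> G x \<le> T.caterpillar_form ys"
      using T.placement_dominates unfolding card .
    interpret P: placement "pverts G" r v ys zs "n - d - 2" "d div 2" "(d - 1) div 2" d by (rule pl)
    let ?y = "x \<circ> P.pl"
    have pD: "pair_graph ?D" by (rule rooted_unicyclic.G[OF Delta2_rooted])
    have neD: "pverts ?D \<noteq> {}" using in_pverts_Delta2(1) by blast
    have norm: "sqnorm ?D ?y = sqnorm G x" using P.sqnorm_place by (simp add: sqnorm_def)
    have norm_pos: "0 < sqnorm G x"
      unfolding sqnorm_def by (intro sum_pos T.finite_verts ne zero_less_power x(1))
    have form_G: "alpha_form \<alpha> G x = ?\<rho> G * sqnorm G x"
      unfolding alpha_form_def sqnorm_def sum_distrib_left
      by (intro sum.cong refl) (simp add: x(2) power2_eq_square)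
    have "alpha_form \<alpha> ?D ?y \<le> ?\<rho> ?D * sqnorm ?D ?y" by (rule alpha_form_le[OF pD neD \<alpha>])
    moreover have "T.caterpillar_form ys = alpha_form \<alpha> ?D ?y"
      unfolding T.caterpillar_form_def P.alpha_form_place by (rule refl)
    ultimately have chain: "?\<rho> G * sqnorm G x \<le> alpha_form \<alpha> ?D ?y"
      "alpha_form \<alpha> ?D ?y \<le> ?\<rho> ?D * sqnorm G x"
      using le form_G norm by simp_all
    then have "?\<rho> G \<le> ?\<rho> ?D" using norm_pos by (meson mult_le_cancel_right_pos order.trans)
    then have eq: "?\<rho> G = ?\<rho> ?D" using not_less by simp
    then have "alpha_form \<alpha> ?D ?y = ?\<rho> ?D * sqnorm ?D ?y" using chain norm by simp
    from alpha_form_eq_imp_eigenvector[OF pD neD \<alpha> this]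
    have eig_D: "alpha_op \<alpha> ?D ?y t = ?\<rho> G * x (P.pl t)" if "t \<in> pverts ?D" for t
      using that eq by simp
    have "tight_unicyclic G r par lev u v p q i j d x \<alpha> cs ys zs (n - d - 2) (d div 2) ((d - 1) div 2)"
      by (rule tight_unicyclic.intro[OF T.two_chain_unicyclic_axioms pl
            tight_unicyclic_axioms.intro[OF ys x(2) eig_D]])
    from tight_unicyclic.iso_U2_star[OF this] show False
      using \<open>\<not> ?iso\<close> unfolding card by blast
  qed
qed

theorem theorem4p1:
  fixes \<alpha> :: real and n d :: nat
  assumes "0 \<le> \<alpha>" and "\<alpha> < 1" and "2 \<le> d" and "d + 2 \<le> n"
  shows "U2_star n d \<in> unicyclic_graphs n d \<and>
    (\<forall>G :: 'a pair_pre_digraph. G \<in> unicyclic_graphs n d \<longrightarrow>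
       \<not> digraph_iso (with_proj G) (with_proj (U2_star n d)) \<longrightarrow>
       alpha_spectral_radius \<alpha> G < alpha_spectral_radius \<alpha> (U2_star n d))"
proof -
  have "U2_star n d = Delta2 (n - d - 2) (d div 2) ((d - 1) div 2)"
    using assms by (intro U2_star_eq) auto
  then show ?thesis
    using U2_star_in_unicyclic_graphs[OF assms(3,4)]
      alpha_spectral_radius_less_or_iso[OF assms(1,2) _ assms(3)] by metis
qed

end
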